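(* Let $f:\mathbb{R}^k\rightarrow \mathbb{R}$ be a $C^{1}$ function such that $\nabla f$ is locally Lipschitz continuous. Assume moreover that $f$ is $C^2$ near its generalised saddle points. Fix real numbers $\delta_0>0$ and $0<\alpha<1$. Then there is a smooth function $h:\mathbb{R}^k\rightarrow (0,\delta_0]$ such that the map $H:\mathbb{R}^k\rightarrow \mathbb{R}^k$ defined by $H(x)=x-h(x)\nabla f(x)$ has the following properties: (i) For all $x\in \mathbb{R}^k$, we have $f(H(x))-f(x)\leq -\alpha h(x)\|\nabla f(x)\|^2$. (ii) For every $x_0\in \mathbb{R}^k$, the sequence defined by $x_{n+1}=H(x_n)$ for $n\ge 0$ satisfies either $\lim_{n\rightarrow\infty}\|x_{n+1}-x_n\|=0$ or $\lim_{n\rightarrow\infty}\|x_n\|=\infty$. Each cluster point of $\{x_n\}$ is a critical point of $f$. If moreover $f$ has at most countably many critical points, then either $\{x_n\}$ converges to a critical point of $f$ or $\lim_{n\rightarrow\infty}\|x_n\|=\infty$. (iii) There is a set $\mathcal{E}_1\subset \mathbb{R}^k$ of Lebesgue measure $0$ such that for all $x_0\in \mathbb{R}^k\setminus \mathcal{E}_1$, the sequence $x_{n+1}=H(x_n)$, if it converges, cannot converge to a generalised saddle point of $f$. (iv) There is a set $\mathcal{E}_2\subset \mathbb{R}^k$ of Lebesgue measure $0$ such that for all $x_0\in \mathbb{R}^k\setminus \mathcal{E}_2$, no cluster point of the sequence $x_{n+1}=H(x_n)$ is a saddle point of $f$, and more generally no cluster point of this sequence is an isolated generalised saddle point of $f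$.
   Context: $\|\cdot\|$ is the Euclidean norm on $\mathbb{R}^k$. "Smooth" means $C^\infty$. A critical point of $f$ is a point where $\nabla f=0$. A point $x_\infty\in\mathbb{R}^k$ is a cluster point of a sequence $\{x_n\}$ if some subsequence of $\{x_n\}$ converges to $x_\infty$. Let $f:\mathbb{R}^k\to\mathbb{R}$ be $C^1$ and let $p$ be a critical point of $f$ such that $f$ is $C^2$ in a neighbourhood of $p$. - $p$ is a saddle point if the Hessian $\nabla^2 f(p)$ is non-singular and has both positive and negative eigenvalues. - $p$ is a generalised saddle point if $\nabla^2 f(p)$ has at least one negative eigenvalue. - A generalised saddle point is isolated if it is an isolated point of the set of critical points of $f$. *)

theory Defs
  imports "HOL-Analysis.Analysis"
begin

text \<open>
  \<open>Ck_on n f S\<close> is meant for open \<open>S\<close>. Taking \<open>v\<close> to be the basis vectors gives the partial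
  derivatives, so in finite dimension this is the usual class \<open>C\<^sup>n\<close>.
\<close>

primrec Ck_on :: "nat \<Rightarrow> ('a::real_normed_vector \<Rightarrow> 'b::real_normed_vector) \<Rightarrow> 'a set \<Rightarrow> bool" where
  "Ck_on 0 f S \<longleftrightarrow> continuous_on S f"
| "Ck_on (Suc n) f S \<longleftrightarrow>
     (\<forall>x\<in>S. f differentiable (at x)) \<and>
     (\<forall>v. Ck_on n (\<lambda>x. frechet_derivative f (at x) v) S)"

definition smooth_on :: "('a::real_normed_vector \<Rightarrow> 'b::real_normed_vector) \<Rightarrow> 'a set \<Rightarrow> bool" where
  "smooth_on f S \<longleftrightarrow> (\<forall>n. Ck_on n f S)"

definition C2_near :: "('a::real_normed_vector \<Rightarrow> 'b::real_normed_vector) \<Rightarrow> 'a \<Rightarrow> bool" where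
  "C2_near f p \<longleftrightarrow> (\<exists>U. open U \<and> p \<in> U \<and> Ck_on 2 f U)"

definition locally_lipschitz :: "('a::metric_space \<Rightarrow> 'b::metric_space) \<Rightarrow> bool" where
  "locally_lipschitz g \<longleftrightarrow> (\<forall>x. \<exists>e>0. \<exists>L. L-lipschitz_on (ball x e) g)"

definition gradient :: "('a::real_inner \<Rightarrow> real) \<Rightarrow> 'a \<Rightarrow> 'a" where
  "gradient f x = (THE D. GDERIV f x :> D)"

lemma gradient_eqI:
  assumes "GDERIV f x :> D"
  shows "gradient f x = D"
  unfolding gradient_def
proof (rule the_equality)
  fix D' assume "GDERIV f x :> D'"
  with assms have "(\<lambda>h. h \<bullet> D') = (\<lambda>h. h \<bullet> D)"
    unfolding gderiv_def by (rule has_derivative_unique[rotated])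
  then have "(D' - D) \<bullet> (D' - D) = 0"
    by (metis inner_diff_right right_minus_eq)
  then show "D' = D" by simp
qed (rule assms)

lemma GDERIV_gradient:
  fixes f :: "'a::euclidean_space \<Rightarrow> real"
  assumes "f differentiable (at x)"
  shows "GDERIV f x :> gradient f x"
proof -
  obtain f' where f': "(f has_derivative f') (at x)"
    using assms by (auto simp: differentiable_def)
  then have "linear f'"
    by (rule has_derivative_linear)
  then have "f' = (\<lambda>h. h \<bullet> adjoint f' 1)"
    by (auto simp: adjoint_works fun_eq_iff)
  with f' have "GDERIV f x :> adjoint f' 1"
    by (simp add: gderiv_def)
  then show ?thesis
    using gradient_eqI by metis
qed

definition hessian :: "(real ^ 'k \<Rightarrow> real) \<Rightarrow> real ^ 'k \<Rightarrow> real ^ 'k ^ 'k" where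
  "hessian f p = jacobian (gradient f) (at p)"

definition eigenvalue :: "real ^ 'k ^ 'k \<Rightarrow> real \<Rightarrow> bool" where
  "eigenvalue A c \<longleftrightarrow> (\<exists>v. v \<noteq> 0 \<and> A *v v = c *\<^sub>R v)"

definition critical_point :: "('a::real_inner \<Rightarrow> real) \<Rightarrow> 'a \<Rightarrow> bool" where
  "critical_point f p \<longleftrightarrow> GDERIV f p :> 0"

text \<open>Saddle points of either kind are only defined at critical points near which \<open>f\<close> is \<open>C\<^sup>2\<close>;
  a hypothesis that \<open>f\<close> be \<open>C\<^sup>2\<close> near its generalised saddle points is therefore automatic.\<close>

definition saddle_point :: "(real ^ 'k \<Rightarrow> real) \<Rightarrow> real ^ 'k \<Rightarrow> bool" where
  "saddle_point f p \<longleftrightarrow> critical_point f p \<and> C2_near f p \<and> invertible (hessian f p) \<and>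
     (\<exists>c>0. eigenvalue (hessian f p) c) \<and> (\<exists>c<0. eigenvalue (hessian f p) c)"

definition generalised_saddle_point :: "(real ^ 'k \<Rightarrow> real) \<Rightarrow> real ^ 'k \<Rightarrow> bool" where
  "generalised_saddle_point f p \<longleftrightarrow> critical_point f p \<and> C2_near f p \<and>
     (\<exists>c<0. eigenvalue (hessian f p) c)"

definition isolated_generalised_saddle_point :: "(real ^ 'k \<Rightarrow> real) \<Rightarrow> real ^ 'k \<Rightarrow> bool" where
  "isolated_generalised_saddle_point f p \<longleftrightarrow>
     generalised_saddle_point f p \<and> p isolated_in {x. critical_point f x}"

definition cluster_point :: "(nat \<Rightarrow> 'a::topological_space) \<Rightarrow> 'a \<Rightarrow> bool" where
  "cluster_point x p \<longleftrightarrow> (\<exists>r. strict_mono r \<and> (x \<circ> r) \<longlonglongrightarrow> p)"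

end

theory Submission
  imports Defs
begin

text \<open>
  Choose \<open>h\<close> as a locally finite sum of smooth bumps with such small coefficients that \<open>h \<nabla>f\<close> is
  globally \<open>1/2\<close>-Lipschitz and, wherever \<open>f\<close> is sampled, \<open>h\<close> times the local Lipschitz constant of
  \<open>\<nabla>f\<close> is at most \<open>1 - \<alpha>\<close>. The latter gives the descent inequality. If \<open>f\<close> stays bounded below along
  an orbit, the steps tend to \<open>0\<close>, and then a cluster point which is not a limit is accompanied by
  cluster points at every small distance; so isolated or countable critical sets force convergence.

  Since \<open>H\<close> is the identity minus a \<open>1/2\<close>-Lipschitz map, it expands distances by a factor of at least
  \<open>1/2\<close> and preimages of null sets are null. It remains to see that the points whose
  orbit stays near a generalised saddle point form a null set. No invariant manifold is needed: a
  quadratic form that is positive on the most unstable directions is expanded along the orbits of pairs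
  of points, so it must be negative on every chord of that set, which makes the set a Lipschitz graph over
  part of a hyperplane. Countably many such neighbourhoods cover the generalised saddle points.
\<close>

section \<open>Smooth functions and bumps\<close>

text \<open>\<open>Ck_on\<close> refers to \<open>frechet_derivative\<close>, which is defined by
  choice; this rule lets an explicit derivative \<open>D\<close> take its place. Openness of
  \<open>S\<close> matters: functions that agree on \<open>S\<close> then agree near each of its
  points and share their derivatives there.\<close>

lemma Ck_on_SucI:
  assumes "\<And>x. x \<in> S \<Longrightarrow> (f has_derivative D x) (at x)"
    and "\<And>v. Ck_on n (\<lambda>x. D x v) S" and "open S"
  shows "Ck_on (Suc n) f S"
proof -
  have cong: "Ck_on n f S \<Longrightarrow> (\<And>x. x \<in> S \<Longrightarrow> f x = g x) \<Longrightarrow> Ck_on n g S" for n and f g :: "'a \<Rightarrow> 'b"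
  proof (induction n arbitrary: f g)
    case 0
    then show ?case by (simp cong: continuous_on_cong)
  next
    case (Suc n)
    have g: "(g has_derivative frechet_derivative f (at x)) (at x)" if "x \<in> S" for x
      using Suc.prems that frechet_derivative_works \<open>open S\<close>
      by (metis Ck_on.simps(2) has_derivative_transform_within_open)
    then have eq: "frechet_derivative g (at x) = frechet_derivative f (at x)" if "x \<in> S" for x
      using that by (metis frechet_derivative_at)
    have "Ck_on n (\<lambda>x. frechet_derivative g (at x) v) S" for v
    proof (rule Suc.IH)
      show "Ck_on n (\<lambda>x. frechet_derivative f (at x) v) S" using Suc.prems(1) by simp
    qed (simp add: eq)
    moreover have "g differentiable (at x)" if "x \<in> S" for x
      using g[OF that] by (rule differentiableI)
    ultimately show ?case by simp
  qed
  have eq: "frechet_derivative f (at x) = D x" if "x \<in> S" for x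
    using assms(1)[OF that] by (metis frechet_derivative_at)
  have "Ck_on n (\<lambda>x. frechet_derivative f (at x) v) S" for v
    by (rule cong[OF assms(2)]) (simp add: eq)
  moreover have "f differentiable (at x)" if "x \<in> S" for x
    using assms(1)[OF that] by (rule differentiableI)
  ultimately show ?thesis by simp
qed

lemma Ck_on_cong:
  assumes "Ck_on n f S" "open S" "\<And>x. x \<in> S \<Longrightarrow> f x = g x"
  shows "Ck_on n g S"
proof (cases n)
  case 0
  with assms show ?thesis by (simp cong: continuous_on_cong)
next
  case (Suc m)
  show ?thesis unfolding Suc
  proof (rule Ck_on_SucI)
    show "(g has_derivative frechet_derivative f (at x)) (at x)" if "x \<in> S" for x
      using assms Suc that frechet_derivative_works
      by (metis Ck_on.simps(2) has_derivative_transform_within_open)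
  qed (use assms Suc in auto)
qed

lemma Ck_on_Suc_imp_Ck_on: "Ck_on (Suc n) f S \<Longrightarrow> Ck_on n f S"
proof (induction n arbitrary: f)
  case 0
  then show ?case
    by (simp add: continuous_at_imp_continuous_on differentiable_imp_continuous_within)
next
  case (Suc n)
  then show ?case by auto
qed

lemma Ck_on_has_derivative:
  assumes "Ck_on (Suc n) f S" "x \<in> S"
  shows "(f has_derivative frechet_derivative f (at x)) (at x)"
  using assms frechet_derivative_works by auto

lemma Ck_on_subset: "Ck_on n f S \<Longrightarrow> T \<subseteq> S \<Longrightarrow> Ck_on n f T"
  by (induction n arbitrary: f) (auto intro: continuous_on_subset)

text \<open>Meant for locally finite series, which are finite sums only near each point.\<close>

lemma Ck_on_local:
  "(\<And>x. x \<in> S \<Longrightarrow> \<exists>T. open T \<and> x \<in> T \<and> Ck_on n f T) \<Longrightarrow> Ck_on n f S"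
proof (induction n arbitrary: f)
  case 0
  then show ?case
    by (metis Ck_on.simps(1) continuous_at_imp_continuous_on continuous_on_eq_continuous_at)
next
  case (Suc n)
  have "f differentiable (at x)" if "x \<in> S" for x
    using Suc.prems[OF that] by auto
  moreover have "Ck_on n (\<lambda>x. frechet_derivative f (at x) v) S" for v
  proof (rule Suc.IH)
    fix x assume "x \<in> S"
    from Suc.prems[OF this] obtain T where "open T" "x \<in> T" "Ck_on (Suc n) f T" by blast
    then show "\<exists>T. open T \<and> x \<in> T \<and> Ck_on n (\<lambda>x. frechet_derivative f (at x) v) T"
      by (intro exI[of _ T]) simp
  qed
  ultimately show ?case by simp
qed

lemma Ck_on_const: "open S \<Longrightarrow> Ck_on n (\<lambda>x. c) S"
proof (induction n arbitrary: c)
  case (Suc n)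
  then show ?case by (intro Ck_on_SucI[where D = "\<lambda>x v. 0"]) auto
qed simp

lemma Ck_on_bounded_linear:
  assumes "bounded_linear f" "open S"
  shows "Ck_on n f S"
proof (cases n)
  case 0
  with assms show ?thesis by (simp add: linear_continuous_on)
next
  case (Suc m)
  with assms show ?thesis
    by (simp only:) (intro Ck_on_SucI[where D = "\<lambda>x. f"] Ck_on_const bounded_linear_imp_has_derivative)
qed

lemma Ck_on_frechet_derivative:
  "Ck_on (Suc n) f S \<Longrightarrow> Ck_on n (\<lambda>x. frechet_derivative f (at x) v) S"
  by simp

lemma Ck_on_add:
  assumes "open S"
  shows "Ck_on n f S \<Longrightarrow> Ck_on n g S \<Longrightarrow> Ck_on n (\<lambda>x. f x + g x) S"
proof (induction n arbitrary: f g)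
  case 0
  then show ?case by (simp add: continuous_on_add)
next
  case (Suc n)
  show ?case
    by (intro Ck_on_SucI[where D = "\<lambda>x v. frechet_derivative f (at x) v + frechet_derivative g (at x) v"]
        has_derivative_add Suc.IH assms Ck_on_has_derivative[OF Suc.prems(1)] Ck_on_has_derivative[OF Suc.prems(2)]
        Ck_on_frechet_derivative[OF Suc.prems(1)] Ck_on_frechet_derivative[OF Suc.prems(2)])
qed

lemma Ck_on_mult:
  fixes f g :: "'a::real_normed_vector \<Rightarrow> real"
  assumes "open S"
  shows "Ck_on n f S \<Longrightarrow> Ck_on n g S \<Longrightarrow> Ck_on n (\<lambda>x. f x * g x) S"
proof (induction n arbitrary: f g)
  case 0
  then show ?case by (simp add: continuous_on_mult)
next
  case (Suc n)
  \<comment> \<open>The product rule leaves one factor undifferentiated, hence the two appeals to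
    \<open>Ck_on_Suc_imp_Ck_on\<close>.\<close>
  show ?case
    by (intro Ck_on_SucI[where D = "\<lambda>x v. f x * frechet_derivative g (at x) v + frechet_derivative f (at x) v * g x"]
        has_derivative_mult Ck_on_add Suc.IH assms
        Ck_on_has_derivative[OF Suc.prems(1)] Ck_on_has_derivative[OF Suc.prems(2)]
        Ck_on_frechet_derivative[OF Suc.prems(1)] Ck_on_frechet_derivative[OF Suc.prems(2)]
        Ck_on_Suc_imp_Ck_on[OF Suc.prems(1)] Ck_on_Suc_imp_Ck_on[OF Suc.prems(2)])
qed

lemma Ck_on_inner_self:
  fixes S :: "'a::euclidean_space set"
  assumes "open S"
  shows "Ck_on n (\<lambda>x. x \<bullet> x) S"
proof (cases n)
  case 0
  show ?thesis unfolding 0 by (simp add: continuous_on_inner continuous_on_id)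
next
  case (Suc m)
  show ?thesis unfolding Suc
  proof (rule Ck_on_SucI[where D = "\<lambda>x v. x \<bullet> v + v \<bullet> x"])
    show "((\<lambda>x. x \<bullet> x) has_derivative (\<lambda>v. x \<bullet> v + v \<bullet> x)) (at x)" for x :: 'a
      by (rule derivative_eq_intros | simp)+
    show "Ck_on m (\<lambda>x. x \<bullet> v + v \<bullet> x) S" for v
      by (intro Ck_on_add Ck_on_bounded_linear bounded_linear_inner_left bounded_linear_inner_right assms)
  qed fact
qed

lemma Ck_on_sum:
  fixes f :: "'i \<Rightarrow> 'a::real_normed_vector \<Rightarrow> 'b::real_normed_vector"
  assumes "open S" "\<And>i. i \<in> I \<Longrightarrow> Ck_on n (f i) S"
  shows "Ck_on n (\<lambda>x. \<Sum>i\<in>I. f i x) S"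
  using assms(2)
proof (induction I rule: infinite_finite_induct)
  case (insert i I)
  then show ?case by (simp add: Ck_on_add[OF assms(1)])
qed (simp_all add: Ck_on_const[OF assms(1)])

section \<open>The flat exponential and the shell bumps\<close>

text \<open>The index \<open>m\<close> makes the family closed under differentiation up to linear
  combinations, so that one induction with \<open>m\<close> arbitrary gives smoothness;
  \<open>expflat 0\<close> is the classical flat function.\<close>

definition expflat :: "nat \<Rightarrow> real \<Rightarrow> real" where
  "expflat m x = (if x > 0 then (1 / x) ^ m * exp (- (1 / x)) else 0)"

text \<open>With y = 1 / x, keep a single term of the exponential series: y^(m+1) / (m+1)! <= exp y.
  The linear bound controls the difference quotients at 0.\<close>

lemma expflat_le: "expflat m x \<le> fact (Suc m) * \<bar>x\<bar>"
  (is "_ \<le> ?c * _")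
proof (cases "x > 0")
  case True
  define y where "y = 1 / x"
  have y: "y > 0" and x: "x = 1 / y" using True by (auto simp: y_def)
  have "y ^ Suc m / fact (Suc m) \<le> exp y"
  proof -
    have "(\<Sum>n\<in>{Suc m}. inverse (fact n) * y ^ n) \<le> (\<Sum>n. inverse (fact n) * y ^ n)"
      by (rule sum_le_suminf[OF summable_exp]) (use y in auto)
    then show ?thesis by (simp add: exp_def scaleR_conv_of_real field_simps)
  qed
  then have "y ^ m * y \<le> fact (Suc m) * exp y" by (simp add: pos_divide_le_eq mult.commute del: fact_Suc)
  then have "y ^ m * exp (- y) \<le> fact (Suc m) * (1 / y)"
    using y by (simp add: exp_minus field_simps del: fact_Suc)
  then show ?thesis using True by (simp add: expflat_def x)
next
  case False
  have "0 \<le> ?c * \<bar>x\<bar>" by (intro mult_nonneg_nonneg) simp_all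
  with False show ?thesis by (simp only: expflat_def if_False)
qed

lemma expflat_has_real_derivative:
  "(expflat m has_real_derivative expflat (m + 2) x - m * expflat (m + 1) x) (at x)"
proof (cases "x = 0")
  case False
  then consider "x > 0" | "x < 0" by linarith
  then show ?thesis
  proof cases
    case 1
    have inv: "((\<lambda>x. 1 / x) has_real_derivative - ((1 / x)\<^sup>2)) (at x)"
      using DERIV_inverse[of x UNIV] 1 by (simp add: inverse_eq_divide power2_eq_square)
    \<comment> \<open>The split on \<open>m\<close> is forced by \<open>m - Suc 0\<close>, which
      truncates at \<open>m = 0\<close>; the factor \<open>real m\<close> vanishes there.\<close>
    have "real m * (- y\<^sup>2 * y ^ (m - Suc 0)) * E + E * - (- y\<^sup>2) * y ^ m =
        y ^ (m + 2) * E - real m * (y ^ (m + 1) * E)" for y E :: real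
      by (cases m) (simp_all add: power2_eq_square algebra_simps)
    from this[of "1 / x" "exp (- (1 / x))"]
    have "real m * (- (1 / x)\<^sup>2 * (1 / x) ^ (m - Suc 0)) * exp (- (1 / x)) +
        exp (- (1 / x)) * - (- (1 / x)\<^sup>2) * (1 / x) ^ m =
        expflat (m + 2) x - m * expflat (m + 1) x"
      using 1 unfolding expflat_def by (simp only: if_True)
    then have "((\<lambda>x. (1 / x) ^ m * exp (- (1 / x))) has_real_derivative
        expflat (m + 2) x - m * expflat (m + 1) x) (at x)"
      by (intro DERIV_cong[OF DERIV_mult[OF DERIV_power[OF inv] DERIV_fun_exp[OF DERIV_minus[OF inv]]]])
        simp
    then show ?thesis
      by (rule has_field_derivative_transform_within_open[of _ _ _ "{0<..}"]) (use 1 in \<open>auto simp: expflat_def\<close>)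
  next
    case 2
    have "((\<lambda>x. 0) has_real_derivative 0) (at x)" by simp
    then have "(expflat m has_real_derivative 0) (at x)"
      by (rule has_field_derivative_transform_within_open[of _ _ _ "{..<0}"]) (use 2 in \<open>auto simp: expflat_def\<close>)
    then show ?thesis using 2 by (simp add: expflat_def)
  qed
next
  case True
  \<comment> \<open>Dividing by \<open>h > 0\<close> raises the index by one, so
    \<open>expflat_le\<close> for \<open>Suc m\<close> bounds the quotient by a multiple of
    |h|.\<close>
  have le: "norm ((expflat m (0 + h) - expflat m 0) / h) \<le> fact (m + 2) * \<bar>h\<bar>" for h
  proof (cases "h > 0")
    case True
    then show ?thesis using expflat_le[of "Suc m" h]
      by (simp add: expflat_def field_simps del: fact_Suc)
  next
    case False
    have "0 \<le> fact (m + 2) * \<bar>h\<bar>" by (intro mult_nonneg_nonneg) simp_all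
    with False show ?thesis by (simp only: expflat_def if_False) simp
  qed
  have "((\<lambda>h. (expflat m (0 + h) - expflat m 0) / h) \<longlongrightarrow> 0) (at 0)"
    by (rule Lim_null_comparison[of _ "\<lambda>h. fact (m + 2) * \<bar>h\<bar>"])
      (use le in \<open>auto intro!: tendsto_eq_intros always_eventually simp del: fact_Suc\<close>)
  then show ?thesis using True by (simp add: DERIV_def expflat_def)
qed

text \<open>The chain rule replaces \<open>expflat m\<close> by the members \<open>m + 1\<close> and
  \<open>m + 2\<close> and multiplies by a derivative of \<open>P\<close>. Hence the induction on
  \<open>n\<close> keeps \<open>P\<close> fixed, with all its orders assumed at once, and varies
  \<open>m\<close>.\<close>

lemma Ck_on_expflat:
  fixes P :: "'a::real_normed_vector \<Rightarrow> real"
  assumes P: "\<And>n. Ck_on n P S" and "open S"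
  shows "Ck_on n (\<lambda>x. expflat m (P x)) S"
proof (induction n arbitrary: m)
  case 0
  have "continuous_on UNIV (expflat m)"
    by (meson DERIV_continuous continuous_at_imp_continuous_on expflat_has_real_derivative)
  then have "continuous_on S (expflat m \<circ> P)"
    using P[of 0] by (intro continuous_on_compose) (auto intro: continuous_on_subset)
  then show ?case by (simp add: o_def)
next
  case (Suc n)
  let ?D = "\<lambda>x v. frechet_derivative P (at x) v"
  show ?case
  proof (rule Ck_on_SucI[where D = "\<lambda>x v. ?D x v * (expflat (m + 2) (P x) + (- real m) * expflat (m + 1) (P x))"])
    fix x assume "x \<in> S"
    then have "(P has_derivative ?D x) (at x)"
      using P[of 1] Ck_on_has_derivative[of 0] by simp
    from has_derivative_compose[OF this expflat_has_real_derivative[unfolded has_field_derivative_def]]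
    show "((\<lambda>x. expflat m (P x)) has_derivative
        (\<lambda>v. ?D x v * (expflat (m + 2) (P x) + (- real m) * expflat (m + 1) (P x)))) (at x)"
      by (simp add: algebra_simps)
  next
    fix v
    show "Ck_on n (\<lambda>x. ?D x v * (expflat (m + 2) (P x) + (- real m) * expflat (m + 1) (P x))) S"
      using P[of "Suc n"] Suc \<open>open S\<close>
      by (intro Ck_on_mult Ck_on_add Ck_on_const Ck_on_frechet_derivative)
  qed fact
qed

text \<open>The bump of the shell \<open>n - 1 < norm x ^ 2 < n + 1\<close>.\<close>

definition bump :: "nat \<Rightarrow> 'a::euclidean_space \<Rightarrow> real" where
  "bump n x = expflat 0 (1 - (x \<bullet> x - real n)\<^sup>2)"

lemma bump_nonneg: "bump n x \<ge> 0" and bump_le_1: "bump n x \<le> 1"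
  by (simp_all add: bump_def expflat_def)

lemma Ck_on_bump: "Ck_on m (bump n :: 'a::euclidean_space \<Rightarrow> real) UNIV"
proof -
  have "Ck_on k (\<lambda>x::'a. 1 + (-1) * ((x \<bullet> x + (- real n)) * (x \<bullet> x + (- real n)))) UNIV" for k
    by (intro Ck_on_add Ck_on_mult Ck_on_const Ck_on_inner_self open_UNIV)
  from Ck_on_expflat[OF this, of m 0] show ?thesis
    by (simp add: bump_def[abs_def] power2_eq_square algebra_simps)
qed

lemma bump_eq_0_iff: "bump n x = 0 \<longleftrightarrow> 1 \<le> \<bar>x \<bullet> x - real n\<bar>"
  using abs_square_less_1[of "x \<bullet> x - real n"] by (simp add: bump_def expflat_def)

lemma bump_pos_ex: "\<exists>n. bump n x > 0"
proof
  have "\<bar>x \<bullet> x - real (nat \<lfloor>x \<bullet> x\<rfloor>)\<bar> < 1"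
    using inner_ge_zero[of x] by linarith
  then have "bump (nat \<lfloor>x \<bullet> x\<rfloor>) x \<noteq> 0" unfolding bump_eq_0_iff by linarith
  then show "bump (nat \<lfloor>x \<bullet> x\<rfloor>) x > 0"
    using bump_nonneg[of "nat \<lfloor>x \<bullet> x\<rfloor>" x] by linarith
qed

text \<open>The bump already vanishes from radius sqrt (n + 1) on; the cruder radius n + 1 avoids
  square roots.\<close>

lemma bump_eq_0_outside:
  assumes "norm x \<ge> real n + 1"
  shows "bump n x = 0"
proof -
  have "(real n + 1) * (real n + 1) \<le> norm x * norm x"
    using assms by (intro mult_mono) auto
  then have "x \<bullet> x \<ge> real n + 1"
    unfolding dot_square_norm power2_eq_square
    by (rule order_trans[rotated]) (simp add: distrib_left distrib_right)
  then show ?thesis by (simp add: bump_eq_0_iff)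
qed

text \<open>The hypothesis says that the partial sums at \<open>x\<close> no longer change from
  index x . x + 1 on, as later shells miss \<open>x\<close>. So near each point \<open>h\<close> is
  one fixed finite sum.\<close>

lemma smooth_on_bump_series:
  fixes h :: "'a::euclidean_space \<Rightarrow> real"
  assumes h: "\<And>x M. x \<bullet> x + 1 \<le> real M \<Longrightarrow> h x = (\<Sum>n<M. c n * bump n x)"
  shows "smooth_on h UNIV"
  unfolding smooth_on_def
proof (intro allI Ck_on_local)
  fix n :: nat and x :: 'a
  \<comment> \<open>The extra 1 makes the same cutoff valid on all of \<open>T\<close>, where y . y
    < x . x + 1.\<close>
  define M where "M = nat \<lceil>x \<bullet> x + 2\<rceil>"
  define T where "T = {y::'a. y \<bullet> y < x \<bullet> x + 1}"
  have "open T" unfolding T_def by (intro open_Collect_less continuous_on_inner continuous_on_id continuous_on_const)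
  moreover have "Ck_on n h T"
  proof (rule Ck_on_cong)
    show "Ck_on n (\<lambda>x. \<Sum>n<M. c n * bump n x) T"
      by (intro Ck_on_sum Ck_on_mult Ck_on_const Ck_on_subset[OF Ck_on_bump subset_UNIV] \<open>open T\<close>)
    fix y assume "y \<in> T"
    then have "y \<bullet> y + 1 \<le> real M" unfolding T_def M_def mem_Collect_eq by linarith
    then show "(\<Sum>n<M. c n * bump n y) = h y" by (simp add: h)
  qed fact
  moreover have "x \<in> T" by (simp add: T_def)
  ultimately show "\<exists>T. open T \<and> x \<in> T \<and> Ck_on n h T" by blast
qed

section \<open>Dynamics near a linearly unstable fixed point\<close>

text \<open>\<open>P\<close> is injective on \<open>S\<close> with a \<open>C\<close>-Lipschitz
  inverse, and Lipschitz maps between spaces of equal dimension preserve null sets.\<close>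

lemma negligible_expanding_image:
  fixes P :: "'a::euclidean_space \<Rightarrow> 'a"
  assumes exp: "\<And>x y. x \<in> S \<Longrightarrow> y \<in> S \<Longrightarrow> norm (x - y) \<le> C * norm (P x - P y)"
    and "negligible (P ` S)"
  shows "negligible S"
proof -
  have inj: "inj_on P S"
    by (intro inj_onI) (use exp in fastforce)
  have "negligible (the_inv_into S P ` P ` S)"
  proof (rule negligible_locally_Lipschitz_image[OF order_refl \<open>negligible (P ` S)\<close>])
    fix z assume "z \<in> P ` S"
    then show "\<exists>T B. open T \<and> z \<in> T \<and> (\<forall>y \<in> P ` S \<inter> T.
        norm (the_inv_into S P y - the_inv_into S P z) \<le> B * norm (y - z))"
      using exp the_inv_into_f_f[OF inj] by (intro exI[of _ UNIV] exI[of _ C]) auto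
  qed
  moreover have "the_inv_into S P ` P ` S = S"
    using the_inv_into_f_f[OF inj] by (force simp: image_image)
  ultimately show ?thesis by simp
qed

text \<open>A set all of whose chords are positive for a quadratic form with a negative direction \<open>v\<close>
  is a Lipschitz graph over part of the hyperplane orthogonal to \<open>v\<close>.\<close>

lemma negligible_if_chords_positive:
  fixes N :: "'a::euclidean_space \<Rightarrow> 'a"
  assumes "linear N" and sym: "\<And>x y. N x \<bullet> y = x \<bullet> N y"
    and bound: "\<And>x. norm (N x) \<le> b * norm x"
    and v: "norm v = 1" "N v = - a *\<^sub>R v" "a > 0"
    and pos: "\<And>x y. x \<in> S \<Longrightarrow> y \<in> S \<Longrightarrow> x \<noteq> y \<Longrightarrow> (x - y) \<bullet> N (x - y) > 0"
  shows "negligible S"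
proof (rule negligible_expanding_image)
  \<comment> \<open>Orthogonal projection along \<open>v\<close>. Its image is null as part of a
    hyperplane, so it remains to bound the chords of \<open>S\<close> by their projections.\<close>
  define P where "P x = x - (x \<bullet> v) *\<^sub>R v" for x
  interpret N: linear N by fact
  have vv: "v \<bullet> v = 1" using v(1) by (simp add: norm_eq_1)
  have b: "b \<ge> 0" using order_trans[OF norm_ge_zero bound[of v]] v(1) by simp
  show "norm (x - y) \<le> sqrt (b / a + 1) * norm (P x - P y)" if "x \<in> S" "y \<in> S" for x y
  proof (cases "x = y")
    case False
    define d s w where "d = x - y" and "s = d \<bullet> v" and "w = P x - P y"
    have d: "d = s *\<^sub>R v + w" unfolding d_def s_def w_def P_def inner_diff_left scaleR_diff_left by simp
    have wv: "w \<bullet> v = 0" using vv by (simp add: w_def P_def inner_diff_left)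
    then have vw: "v \<bullet> w = 0" by (simp add: inner_commute)
    \<comment> \<open>The mixed terms vanish because \<open>v\<close> is an eigenvector and
      \<open>N\<close> is symmetric; positivity of the chord then reads a s^2 < w . N w <= b
      |w|^2.\<close>
    have "w \<bullet> N v = 0" "v \<bullet> N w = 0" using vw wv sym[of v w] by (simp_all add: v(2))
    then have "d \<bullet> N d = - a * s\<^sup>2 + w \<bullet> N w"
      using vv wv
      by (simp add: d N.add N.scaleR inner_add_left inner_add_right inner_diff_right v(2) power2_eq_square
          right_diff_distrib)
    moreover have "d \<bullet> N d > 0" using pos[OF that False] by (simp add: d_def)
    moreover have "w \<bullet> N w \<le> b * (norm w)\<^sup>2"
      using Cauchy_Schwarz_ineq2[of w "N w"] bound[of w] mult_left_mono[of "norm (N w)" "b * norm w" "norm w"]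
      by (simp add: power2_eq_square mult.left_commute)
    ultimately have "s\<^sup>2 \<le> b / a * (norm w)\<^sup>2" using v(3) by (simp add: field_simps)
    moreover have "(norm d)\<^sup>2 = s\<^sup>2 + (norm w)\<^sup>2"
      using vv vw wv by (simp add: d power2_norm_eq_inner inner_add_left inner_add_right)
        (simp add: power2_eq_square)
    ultimately have "(norm d)\<^sup>2 \<le> (b / a + 1) * (norm w)\<^sup>2" by (simp add: algebra_simps)
    then have "norm d \<le> sqrt ((b / a + 1) * (norm w)\<^sup>2)" by (rule real_le_rsqrt)
    then show ?thesis by (simp add: real_sqrt_mult d_def w_def)
  qed simp
  show "negligible (P ` S)"
  proof (rule negligible_subset)
    show "negligible {x. v \<bullet> x = 0}" using v(1) by (intro negligible_hyperplane) auto
    show "P ` S \<subseteq> {x. v \<bullet> x = 0}" using vv by (auto simp: P_def inner_diff_right inner_commute)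
  qed
qed

text \<open>Eigenvectors for distinct eigenvalues are orthogonal, hence independent, so there are no
  more eigenvalues than dimensions.\<close>

lemma finite_symmetric_eigenvalues:
  fixes S :: "'a::euclidean_space \<Rightarrow> 'a"
  assumes sym: "\<And>x y. S x \<bullet> y = x \<bullet> S y"
  shows "finite {c. \<exists>v. v \<noteq> 0 \<and> S v = c *\<^sub>R v}" (is "finite ?E")
proof -
  have "\<forall>c\<in>?E. \<exists>v. v \<noteq> 0 \<and> S v = c *\<^sub>R v" by blast
  from bchoice[OF this] obtain v where v: "\<And>c. c \<in> ?E \<Longrightarrow> v c \<noteq> 0 \<and> S (v c) = c *\<^sub>R v c"
    by blast
  have orth: "v c \<bullet> v d = 0" if "c \<in> ?E" "d \<in> ?E" "c \<noteq> d" for c d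
    using sym[of "v c" "v d"] v[OF that(1)] v[OF that(2)] that(3) by simp
  have "inj_on v ?E"
  proof (intro inj_onI, rule ccontr)
    fix c d assume "c \<in> ?E" "d \<in> ?E" "v c = v d" "c \<noteq> d"
    then show False using orth[of c d] v[of d] by simp
  qed
  moreover have "finite (v ` ?E)"
  proof (rule independent_imp_finite[OF pairwise_orthogonal_independent])
    show "pairwise orthogonal (v ` ?E)"
    proof (intro pairwiseI, elim imageE)
      fix x y c d assume "x = v c" "c \<in> ?E" "y = v d" "d \<in> ?E" "x \<noteq> y"
      then show "orthogonal x y" using orth[of c d] unfolding orthogonal_def by blast
    qed
    show "0 \<notin> v ` ?E"
    proof
      assume "0 \<in> v ` ?E"
      then obtain c where "c \<in> ?E" "0 = v c" by (rule imageE)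
      with v[of c] show False by simp
    qed
  qed
  ultimately show ?thesis by (rule finite_imageD[rotated])
qed

text \<open>Finitely many eigenvalues cannot fill the interval (c, 0), so some
  \<open>- \<sigma>\<close> in it is missed and the shifted map is injective. The shift copes with
  degenerate Hessians: kernel directions become positive, while an eigenvector for \<open>c\<close>
  stays negative.\<close>

lemma shift_off_spectrum:
  fixes S :: "'a::euclidean_space \<Rightarrow> 'a"
  assumes "linear S" "\<And>x y. S x \<bullet> y = x \<bullet> S y" "c < 0"
  obtains \<sigma> m where "0 < \<sigma>" "\<sigma> < - c" "m > 0" "\<And>x. m * norm x \<le> norm (S x + \<sigma> *\<^sub>R x)"
proof -
  have "infinite ({c<..<0} - {c. \<exists>v. v \<noteq> 0 \<and> S v = c *\<^sub>R v})"
    by (rule Diff_infinite_finite[OF finite_symmetric_eigenvalues[OF assms(2)] infinite_Ioo[OF assms(3)]])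
  then obtain \<tau> where "\<tau> \<in> {c<..<0} - {c. \<exists>v. v \<noteq> 0 \<and> S v = c *\<^sub>R v}"
    using infinite_imp_nonempty[THEN ex_in_conv[THEN iffD2], THEN exE] by blast
  then have \<tau>: "c < \<tau>" "\<tau> < 0" "\<And>v. S v = \<tau> *\<^sub>R v \<Longrightarrow> v = 0"
    by auto
  have lin: "linear (\<lambda>x. S x + (- \<tau>) *\<^sub>R x)"
    by (intro linear_compose_add assms) (simp add: linear_iff algebra_simps)
  have "inj (\<lambda>x. S x + (- \<tau>) *\<^sub>R x)"
    unfolding linear_injective_0[OF lin] using \<tau>(3) by simp
  from linear_inj_bounded_below_pos[OF lin this] \<tau> that[of "- \<tau>"] show ?thesis by auto
qed

text \<open>With \<open>N = S + \<sigma>\<close> and \<open>\<beta> = 1 + \<sigma>\<close> the linear part is \<open>\<beta> - N\<close>, and it expands the form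
  \<open>q d = - d \<bullet> N d\<close>: the factor is \<open>\<beta>\<^sup>2\<close>, and the surplus \<open>\<beta> (norm (N d))\<^sup>2\<close> absorbs the error \<open>e\<close>.\<close>

lemma quadratic_form_expansion:
  fixes N :: "'a::euclidean_space \<Rightarrow> 'a"
  assumes "linear N" and sym: "\<And>x y. N x \<bullet> y = x \<bullet> N y"
    and bound: "\<And>x. norm (N x) \<le> \<beta> * norm x" and "\<beta> \<ge> 1"
    and m: "\<And>x. m * norm x \<le> norm (N x)" "m > 0"
    and A: "norm (\<beta> *\<^sub>R d - N d) \<le> 2 * norm d"
    and e: "norm e \<le> \<epsilon> * norm d" "0 < \<epsilon>" "\<epsilon> \<le> 1" "10 * \<beta> * \<epsilon> \<le> m\<^sup>2"
    and d': "d' = \<beta> *\<^sub>R d - N d - e"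
  shows "- (d' \<bullet> N d') \<ge> \<beta>\<^sup>2 * - (d \<bullet> N d) + m\<^sup>2 / 2 * (norm d)\<^sup>2"
proof -
  interpret N: linear N by fact
  have inner_N: "\<bar>x \<bullet> N y\<bar> \<le> \<beta> * (norm x * norm y)" for x y
    using Cauchy_Schwarz_ineq2[of x "N y"] mult_left_mono[OF bound[of y], of "norm x"]
    by (simp add: mult.left_commute)
  define A where "A = \<beta> *\<^sub>R d - N d"
  have "d \<bullet> N (N d) = N d \<bullet> N d" by (simp add: sym)
  then have "- (A \<bullet> N A) = \<beta>\<^sup>2 * - (d \<bullet> N d) + 2 * \<beta> * (N d \<bullet> N d) - N d \<bullet> N (N d)"
    by (simp add: A_def N.diff N.scaleR inner_diff_left inner_diff_right power2_eq_square algebra_simps)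
  \<comment> \<open>This cancels one of the two copies of \<beta> |N d|^2; the other one becomes the
    surplus m^2 |d|^2.\<close>
  moreover have "N d \<bullet> N (N d) \<le> \<beta> * (N d \<bullet> N d)"
    using inner_N[of "N d" "N d"] by (simp add: dot_square_norm power2_eq_square)
  moreover have "m\<^sup>2 * (norm d)\<^sup>2 \<le> \<beta> * (N d \<bullet> N d)"
  proof -
    have "(m * norm d)\<^sup>2 \<le> (norm (N d))\<^sup>2" using m by (intro power_mono) auto
    also have "\<dots> \<le> \<beta> * (norm (N d))\<^sup>2" using mult_right_mono[OF \<open>\<beta> \<ge> 1\<close>, of "(norm (N d))\<^sup>2"] by simp
    finally show ?thesis by (simp add: power_mult_distrib dot_square_norm)
  qed
  ultimately have qA: "- (A \<bullet> N A) \<ge> \<beta>\<^sup>2 * - (d \<bullet> N d) + m\<^sup>2 * (norm d)\<^sup>2" by linarith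
  \<comment> \<open>Symmetry merges the cross terms. The total error is at most (4 + 1) \<beta>
    \<epsilon> |d|^2, which by 10 \<beta> \<epsilon> <= m^2 is at most half of the surplus.\<close>
  have "A \<bullet> N e = e \<bullet> N A" by (metis sym inner_commute)
  then have "- (d' \<bullet> N d') = - (A \<bullet> N A) + 2 * (e \<bullet> N A) - e \<bullet> N e"
    by (simp add: d' A_def[symmetric] N.diff inner_diff_left inner_diff_right algebra_simps)
  moreover have "\<bar>e \<bullet> N A\<bar> \<le> \<beta> * (\<epsilon> * norm d * (2 * norm d))"
    using A e \<open>\<beta> \<ge> 1\<close> by (intro order_trans[OF inner_N] mult_left_mono mult_mono) (auto simp: A_def)
  moreover have "\<bar>e \<bullet> N e\<bar> \<le> \<beta> * (\<epsilon> * norm d * (1 * norm d))"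
    using e \<open>\<beta> \<ge> 1\<close> mult_right_mono[OF \<open>\<epsilon> \<le> 1\<close>, of "norm d"]
    by (intro order_trans[OF inner_N] mult_left_mono mult_mono) auto
  moreover have "10 * \<beta> * \<epsilon> * (norm d * norm d) \<le> m\<^sup>2 * (norm d * norm d)"
    using e(4) by (intro mult_right_mono) auto
  ultimately show ?thesis using qA by (simp add: power2_eq_square[of "norm d"])
qed

text \<open>If two trapped orbits start with a difference on which \<open>q\<close> is nonnegative,
  then \<open>q\<close> grows at least geometrically along their differences, which contradicts
  boundedness. So \<open>N\<close> is positive on all chords of the trapped set and
  \<open>negligible_if_chords_positive\<close> applies.\<close>

lemma negligible_trapped_set:
  fixes T F S :: "'a::euclidean_space \<Rightarrow> 'a"
  assumes T: "\<And>x. T x = x - F x"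
    and strict: "\<And>\<epsilon>. \<epsilon> > 0 \<Longrightarrow> \<exists>r>0. \<forall>x\<in>cball p r. \<forall>y\<in>cball p r.
        norm (F x - F y - S (x - y)) \<le> \<epsilon> * norm (x - y)"
    and S: "linear S" "\<And>x y. S x \<bullet> y = x \<bullet> S y" "\<And>x. norm (S x) \<le> norm x"
    and v: "v \<noteq> 0" "S v = c *\<^sub>R v" "c < 0"
  shows "\<exists>r>0. negligible {x. \<forall>n. (T ^^ n) x \<in> cball p r}"
proof -
  obtain \<sigma> m where \<sigma>: "0 < \<sigma>" "\<sigma> < - c" and m: "m > 0" "\<And>x. m * norm x \<le> norm (S x + \<sigma> *\<^sub>R x)"
    using shift_off_spectrum[OF S(1,2) v(3)] by blast
  define N where "N x = S x + \<sigma> *\<^sub>R x" for x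
  define \<beta> where "\<beta> = 1 + \<sigma>"
  have \<beta>: "\<beta> > 1" using \<sigma> by (simp add: \<beta>_def)
  have N: "linear N" unfolding N_def
    by (intro linear_compose_add S) (simp add: linear_iff algebra_simps)
  have Nsym: "N x \<bullet> y = x \<bullet> N y" for x y
    by (simp add: N_def inner_add_left inner_add_right S(2))
  have Nbound: "norm (N x) \<le> \<beta> * norm x" for x
    unfolding N_def \<beta>_def by (rule norm_triangle_le) (use S(3)[of x] \<sigma> in \<open>simp add: algebra_simps\<close>)
  \<comment> \<open>The largest error that \<open>quadratic_form_expansion\<close> admits.\<close>
  define \<epsilon> where "\<epsilon> = min 1 (m\<^sup>2 / (10 * \<beta>))"
  have \<epsilon>: "0 < \<epsilon>" "\<epsilon> \<le> 1" "10 * \<beta> * \<epsilon> \<le> m\<^sup>2"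
    using \<beta> m(1) min.cobounded2[of 1 "m\<^sup>2 / (10 * \<beta>)"] unfolding \<epsilon>_def[symmetric]
    by (auto simp: pos_le_divide_eq mult.commute[of \<epsilon>]) (simp_all add: \<epsilon>_def)
  obtain r where r: "r > 0" "\<And>x y. x \<in> cball p r \<Longrightarrow> y \<in> cball p r \<Longrightarrow>
      norm (F x - F y - S (x - y)) \<le> \<epsilon> * norm (x - y)"
    using strict[OF \<epsilon>(1)] by blast
  define q where "q d = - (d \<bullet> N d)" for d
  have step: "q (T x - T y) \<ge> \<beta>\<^sup>2 * q (x - y) + m\<^sup>2 / 2 * (norm (x - y))\<^sup>2"
    if "x \<in> cball p r" "y \<in> cball p r" for x y
    unfolding q_def
  proof (rule quadratic_form_expansion[OF N Nsym Nbound _ _ m(1) _ r(2)[OF that] \<epsilon>])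
    show "norm (\<beta> *\<^sub>R (x - y) - N (x - y)) \<le> 2 * norm (x - y)"
      using S(3)[of "x - y"] norm_triangle_ineq4[of "x - y" "S (x - y)"]
      by (simp add: N_def \<beta>_def algebra_simps)
    show "T x - T y = \<beta> *\<^sub>R (x - y) - N (x - y) - (F x - F y - S (x - y))"
      by (simp add: T N_def \<beta>_def algebra_simps)
  qed (use \<beta> m(2) in \<open>auto simp: N_def\<close>)
  have neg: "(x - y) \<bullet> N (x - y) > 0"
    if x: "\<And>n. (T ^^ n) x \<in> cball p r" and y: "\<And>n. (T ^^ n) y \<in> cball p r" and "x \<noteq> y" for x y
  proof (rule ccontr)
    assume "\<not> (x - y) \<bullet> N (x - y) > 0"
    then have q0: "q (x - y) \<ge> 0" by (simp add: q_def)
    define d where "d n = (T ^^ n) x - (T ^^ n) y" for n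
    \<comment> \<open>The surplus of the first step: it makes \<open>q\<close> positive after one
      iterate even if it is 0 at the start.\<close>
    define \<kappa> where "\<kappa> = m\<^sup>2 / 2 * (norm (x - y))\<^sup>2"
    have \<kappa>: "\<kappa> > 0" using m(1) \<open>x \<noteq> y\<close> by (simp add: \<kappa>_def)
    have d_Suc: "q (d (Suc n)) \<ge> \<beta>\<^sup>2 * q (d n) + m\<^sup>2 / 2 * (norm (d n))\<^sup>2" for n
      using step[OF x y, of n n] by (simp add: d_def)
    have growth: "q (d (Suc n)) \<ge> (\<beta>\<^sup>2) ^ n * \<kappa>" for n
    proof (induction n)
      case 0
      have "0 \<le> \<beta>\<^sup>2 * q (x - y)" using q0 by simp
      then show ?case using d_Suc[of 0] by (simp add: d_def \<kappa>_def)
    next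
      case (Suc n)
      have "(\<beta>\<^sup>2) ^ Suc n * \<kappa> \<le> \<beta>\<^sup>2 * q (d (Suc n))" using mult_left_mono[OF Suc, of "\<beta>\<^sup>2"] by (simp add: mult.assoc)
      also have "\<dots> \<le> q (d (Suc (Suc n)))"
        by (rule order_trans[OF _ d_Suc]) simp
      finally show ?case .
    qed
    have "norm (d n) \<le> 2 * r" for n
      using norm_triangle_ineq4[of "(T ^^ n) x - p" "(T ^^ n) y - p"] x[of n] y[of n]
      by (simp add: d_def dist_norm norm_minus_commute)
    then have "q (d n) \<le> \<beta> * (2 * r * (2 * r))" for n
    proof -
      have "q (d n) \<le> norm (d n) * norm (N (d n))"
        using Cauchy_Schwarz_ineq2[of "d n" "N (d n)"] by (simp add: q_def)
      also have "\<dots> \<le> norm (d n) * (\<beta> * norm (d n))" by (intro mult_left_mono Nbound) auto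
      also have "\<dots> = \<beta> * (norm (d n) * norm (d n))" by simp
      also have "\<dots> \<le> \<beta> * (2 * r * (2 * r))"
        using \<open>\<And>n. norm (d n) \<le> 2 * r\<close> \<beta> r(1) by (intro mult_left_mono mult_mono) auto
      finally show ?thesis .
    qed
    moreover obtain n where "\<beta> * (2 * r * (2 * r)) / \<kappa> < (\<beta>\<^sup>2) ^ n"
      using real_arch_pow[of "\<beta>\<^sup>2"] \<beta> by (metis one_less_power pos2)
    ultimately show False using growth[of n] \<kappa> by (simp add: divide_less_eq) (meson not_le order_trans)
  qed
  have "negligible {x. \<forall>n. (T ^^ n) x \<in> cball p r}"
  proof (rule negligible_if_chords_positive[OF N Nsym Nbound])
    \<comment> \<open>\<open>sgn v\<close> is the unit vector along \<open>v\<close>; its eigenvalue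
      for \<open>N\<close> is c + \<sigma> < 0.\<close>
    show "norm (sgn v) = 1" using v by (simp add: norm_sgn)
    show "N (sgn v) = - (- c - \<sigma>) *\<^sub>R sgn v"
      using v by (simp add: N_def sgn_div_norm linear_cmul[OF S(1)] algebra_simps)
    show "- c - \<sigma> > 0" using \<sigma> by simp
  qed (use neg in blast)
  with r(1) show ?thesis by blast
qed

section \<open>Strict differentiability and the symmetry of the Hessian\<close>

text \<open>The mean value inequality for \<open>F\<close> minus its linear part at
  \<open>p\<close>, on a ball where \<open>F'\<close> is uniformly close to \<open>F' p\<close>.
  Continuity is given direction by direction; the tolerance \<epsilon> / DIM in each basis direction
  adds up to \<epsilon> in operator norm.\<close>

lemma strict_derivative_if_continuous:
  fixes F :: "'a::euclidean_space \<Rightarrow> 'b::real_normed_vector"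
  assumes "open U" "p \<in> U"
    and deriv: "\<And>x. x \<in> U \<Longrightarrow> (F has_derivative F' x) (at x)"
    and cont: "\<And>b. b \<in> Basis \<Longrightarrow> continuous_on U (\<lambda>x. F' x b)"
    and "\<epsilon> > 0"
  shows "\<exists>r>0. \<forall>x\<in>cball p r. \<forall>y\<in>cball p r. norm (F x - F y - F' p (x - y)) \<le> \<epsilon> * norm (x - y)"
proof -
  have "\<forall>\<^sub>F x in nhds p. norm (F' x b - F' p b) < \<epsilon> / DIM('a)" if "b \<in> Basis" for b
  proof -
    have "continuous (at p) (\<lambda>x. F' x b)"
      using cont[OF that] assms(1,2) continuous_on_eq_continuous_at by blast
    then have "((\<lambda>x. F' x b) \<longlongrightarrow> F' p b) (at p)" by (simp add: isCont_def)
    then show ?thesis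
      using tendstoD[of "\<lambda>x. F' x b" "F' p b" "at p" "\<epsilon> / DIM('a)"] \<open>\<epsilon> > 0\<close>
      by (simp add: dist_norm eventually_nhds_conv_at)
  qed
  then have "\<forall>\<^sub>F x in nhds p. x \<in> U \<and> (\<forall>b\<in>Basis. norm (F' x b - F' p b) < \<epsilon> / DIM('a))"
    using assms(1,2) by (auto simp: eventually_conj_iff eventually_nhds_in_open eventually_ball_finite_distrib)
  then obtain r where r: "r > 0" "\<And>x. dist x p \<le> r \<Longrightarrow> x \<in> U \<and> (\<forall>b\<in>Basis. norm (F' x b - F' p b) < \<epsilon> / DIM('a))"
    unfolding eventually_nhds_metric_le by blast
  have onorm: "onorm (F' x - F' p) \<le> \<epsilon>" if "x \<in> cball p r" for x
  proof (rule onorm_le)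
    fix v
    have x: "x \<in> U" using r(2)[of x] that by (simp add: dist_commute)
    interpret D: linear "\<lambda>v. F' x v - F' p v"
      using x assms(2) deriv by (intro linear_compose_sub has_derivative_linear)
    have "norm (F' x v - F' p v) = norm (\<Sum>b\<in>Basis. (v \<bullet> b) *\<^sub>R (F' x b - F' p b))"
      using arg_cong[OF euclidean_representation[of v], of "\<lambda>v. F' x v - F' p v"]
      by (simp only: D.sum D.scaleR)
    also have "\<dots> \<le> (\<Sum>b\<in>(Basis::'a set). norm v * (\<epsilon> / DIM('a)))"
    proof (intro order_trans[OF norm_sum] sum_mono)
      fix b :: 'a assume b: "b \<in> Basis"
      then have "norm (F' x b - F' p b) \<le> \<epsilon> / DIM('a)"
        using r(2)[of x] that by (simp add: dist_commute less_imp_le)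
      then show "norm ((v \<bullet> b) *\<^sub>R (F' x b - F' p b)) \<le> norm v * (\<epsilon> / DIM('a))"
        unfolding norm_scaleR using Basis_le_norm[OF b, of v] by (intro mult_mono) auto
    qed
    also have "\<dots> = \<epsilon> * norm v" by simp
    finally show "norm ((F' x - F' p) v) \<le> \<epsilon> * norm v" by simp
  qed
  have "norm (F x - F y - F' p (x - y)) \<le> \<epsilon> * norm (x - y)" if "x \<in> cball p r" "y \<in> cball p r" for x y
  proof -
    have "norm (F x - F y - F' p (x - y)) \<le> norm (x - y) * \<epsilon>"
    proof (rule differentiable_bound_linearization[where S = "cball p r" and f' = F'])
      show "y + t *\<^sub>R (x - y) \<in> cball p r" if "t \<in> {0..1}" for t
        using convexD_alt[OF convex_cball \<open>y \<in> cball p r\<close> \<open>x \<in> cball p r\<close>, of t] that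
        by (simp add: algebra_simps)
      show "(F has_derivative F' z) (at z within cball p r)" if "z \<in> cball p r" for z
        using deriv r(2)[of z] that by (auto intro: has_derivative_at_withinI simp: dist_commute)
      show "onorm (F' z - F' p) \<le> \<epsilon>" if "z \<in> cball p r" for z
        using that by (rule onorm)
    qed (use r(1) in auto)
    then show ?thesis by (simp add: mult.commute)
  qed
  with r(1) show ?thesis by blast
qed

text \<open>Both orders of differencing approximate the same mixed second difference of \<open>f\<close>.\<close>

lemma strict_derivative_gradient_symmetric:
  fixes f :: "'a::euclidean_space \<Rightarrow> real"
  assumes f: "\<And>x. (f has_derivative (\<lambda>h. h \<bullet> G x)) (at x)"
    and "linear M"
    and strict: "\<And>\<epsilon>. \<epsilon> > 0 \<Longrightarrow> \<exists>r>0. \<forall>x\<in>cball p r. \<forall>y\<in>cball p r.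
        norm (G x - G y - M (x - y)) \<le> \<epsilon> * norm (x - y)"
  shows "M u \<bullet> v = u \<bullet> M v"
proof -
  have mixed: "\<bar>(f (p + u + v) - f (p + u) - (f (p + v) - f p)) - u \<bullet> M v\<bar> \<le> \<epsilon> * (norm u * norm v)"
    if r: "\<And>x y. x \<in> cball p r \<Longrightarrow> y \<in> cball p r \<Longrightarrow> norm (G x - G y - M (x - y)) \<le> \<epsilon> * norm (x - y)"
      and uv: "norm u + norm v \<le> r" for u v r \<epsilon>
  proof -
    \<comment> \<open>The second difference is the increment of \<open>?\<phi>\<close> over [0, 1].
      The mean value theorem turns it into a difference of gradients at two points \<open>v\<close>
      apart, which \<open>M v\<close> approximates.\<close>
    let ?\<phi> = "\<lambda>s. f (p + s *\<^sub>R u + v) - f (p + s *\<^sub>R u)"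
    have "(?\<phi> has_real_derivative u \<bullet> (G (p + s *\<^sub>R u + v) - G (p + s *\<^sub>R u))) (at s)" for s
      unfolding has_field_derivative_def
      by (rule derivative_eq_intros has_derivative_compose[OF _ f] refl)+
        (auto simp: inner_diff_right algebra_simps)
    then obtain s where s: "0 < s" "s < 1"
      "?\<phi> 1 - ?\<phi> 0 = u \<bullet> (G (p + s *\<^sub>R u + v) - G (p + s *\<^sub>R u))"
      using MVT2[of 0 1 ?\<phi> "\<lambda>s. u \<bullet> (G (p + s *\<^sub>R u + v) - G (p + s *\<^sub>R u))"] by auto
    have su: "norm (s *\<^sub>R u) \<le> norm u" using s mult_right_mono[of s 1 "norm u"] by simp
    have mem: "p + w \<in> cball p r" if "norm w \<le> r" for w using that by (simp add: dist_norm)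
    have "norm (s *\<^sub>R u + v) \<le> r" using norm_triangle_ineq[of "s *\<^sub>R u" v] su uv by linarith
    moreover have "norm (s *\<^sub>R u) \<le> r" using su uv norm_ge_zero[of v] by linarith
    ultimately have "norm (G (p + s *\<^sub>R u + v) - G (p + s *\<^sub>R u) - M v) \<le> \<epsilon> * norm v"
      using r[of "p + (s *\<^sub>R u + v)" "p + s *\<^sub>R u"] mem[of "s *\<^sub>R u + v"] mem[of "s *\<^sub>R u"]
      by (simp add: add.assoc del: mem_cball)
    then have "\<bar>u \<bullet> (G (p + s *\<^sub>R u + v) - G (p + s *\<^sub>R u) - M v)\<bar> \<le> norm u * (\<epsilon> * norm v)"
      by (meson Cauchy_Schwarz_ineq2 mult_left_mono norm_ge_zero order_trans)
    then show ?thesis using s(3) by (simp add: inner_diff_right mult.left_commute algebra_simps)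
  qed
  have le: "\<bar>u \<bullet> M v - v \<bullet> M u\<bar> \<le> 2 * \<epsilon> * (norm u * norm v)" if "\<epsilon> > 0" for \<epsilon>
  proof -
    obtain r where r: "r > 0" "\<And>x y. x \<in> cball p r \<Longrightarrow> y \<in> cball p r \<Longrightarrow>
        norm (G x - G y - M (x - y)) \<le> \<epsilon> * norm (x - y)"
      using strict[OF \<open>\<epsilon> > 0\<close>] by blast
    \<comment> \<open>Scaling both vectors by \<open>t\<close> brings them into the ball; the
      estimate is homogeneous of degree 2, so t^2 cancels.\<close>
    define t where "t = r / (norm u + norm v + 1)"
    have pos: "norm u + norm v + 1 > 0" by (smt (verit) norm_ge_zero)
    then have t: "t > 0" using r(1) by (simp add: t_def)
    have "t * (norm u + norm v) \<le> r"
      using r(1) pos by (simp add: t_def field_simps)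
    then have uv: "norm (t *\<^sub>R u) + norm (t *\<^sub>R v) \<le> r" using t by (simp add: algebra_simps)
    have "\<bar>t *\<^sub>R u \<bullet> M (t *\<^sub>R v) - t *\<^sub>R v \<bullet> M (t *\<^sub>R u)\<bar> \<le> 2 * (\<epsilon> * (norm (t *\<^sub>R u) * norm (t *\<^sub>R v)))"
      using mixed[OF r(2) uv] mixed[OF r(2) uv[unfolded add.commute[of "norm (t *\<^sub>R u)"]]]
      by (simp add: algebra_simps)
    then have "t\<^sup>2 * \<bar>u \<bullet> M v - v \<bullet> M u\<bar> \<le> t\<^sup>2 * (2 * \<epsilon> * (norm u * norm v))"
      using t by (simp add: linear_cmul[OF \<open>linear M\<close>] power2_eq_square abs_mult flip: right_diff_distrib)
    then show ?thesis using t by simp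
  qed
  have "\<bar>u \<bullet> M v - v \<bullet> M u\<bar> \<le> 0"
  proof (rule field_le_epsilon)
    fix e :: real assume "e > 0"
    define k where "k = norm u * norm v"
    have k: "k \<ge> 0" by (simp add: k_def)
    have "\<bar>u \<bullet> M v - v \<bullet> M u\<bar> \<le> 2 * (e / (2 * (k + 1))) * k"
      using le[of "e / (2 * (k + 1))"] k \<open>e > 0\<close> by (simp add: k_def[symmetric])
    also have "\<dots> \<le> 0 + e" using k \<open>e > 0\<close> by (simp add: field_simps)
    finally show "\<bar>u \<bullet> M v - v \<bullet> M u\<bar> \<le> 0 + e" .
  qed
  then show ?thesis by (simp add: inner_commute)
qed

section \<open>A smooth step size\<close>

lemma locally_lipschitz_on_compact:
  assumes "locally_lipschitz g" "compact K"
  obtains L where "L-lipschitz_on K g"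
proof -
  \<comment> \<open>\<open>local_lipschitz\<close> describes time-dependent families; the single
    time 0 turns it into a statement about \<open>g\<close>.\<close>
  have "local_lipschitz {0::real} UNIV (\<lambda>_. g)"
  proof (rule local_lipschitzI)
    fix t :: real and x assume "t \<in> {0}"
    obtain e L where "e > 0" "L-lipschitz_on (ball x e) g"
      using assms(1) unfolding locally_lipschitz_def by blast
    moreover have "cball x (e / 2) \<subseteq> ball x e" using \<open>e > 0\<close> by auto
    ultimately have "L-lipschitz_on (cball x (e / 2) \<inter> UNIV) g"
      by (auto intro: lipschitz_on_subset)
    with \<open>e > 0\<close> show "\<exists>u>0. \<exists>L. \<forall>t\<in>cball t u \<inter> {0}. L-lipschitz_on (cball x u \<inter> UNIV) g"
      by (intro exI[of _ "e / 2"]) auto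
  qed
  then have "local_lipschitz {0::real} K (\<lambda>_. g)"
    by (rule local_lipschitz_subset) auto
  from local_lipschitz_compact_implies_lipschitz[OF this assms(2)] that show ?thesis by auto
qed

text \<open>Strict differentiability with error 1 yields the local constant 1 + B, where
  \<open>B\<close> bounds the derivative at the centre.\<close>

lemma Ck_on_1_imp_locally_lipschitz:
  fixes f :: "'a::euclidean_space \<Rightarrow> 'b::real_normed_vector"
  assumes f: "Ck_on 1 f UNIV"
  shows "locally_lipschitz f"
  unfolding locally_lipschitz_def
proof
  fix p
  let ?D = "\<lambda>x. frechet_derivative f (at x)"
  have D: "(f has_derivative ?D x) (at x)" for x
    using f frechet_derivative_works[of f "at x"] by auto
  have "\<exists>r>0. \<forall>x\<in>cball p r. \<forall>y\<in>cball p r. norm (f x - f y - ?D p (x - y)) \<le> 1 * norm (x - y)"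
    by (rule strict_derivative_if_continuous[of UNIV]) (use D f in auto)
  then obtain r where r: "r > 0" "\<And>x y. x \<in> cball p r \<Longrightarrow> y \<in> cball p r \<Longrightarrow>
      norm (f x - f y - ?D p (x - y)) \<le> 1 * norm (x - y)"
    by blast
  obtain B where B: "B > 0" "\<And>v. norm (?D p v) \<le> norm v * B"
    using bounded_linear.pos_bounded[OF has_derivative_bounded_linear[OF D]] by blast
  have "(1 + B)-lipschitz_on (ball p r) f"
  proof (rule lipschitz_onI)
    fix x y assume "x \<in> ball p r" "y \<in> ball p r"
    then have "norm (f x - f y - ?D p (x - y)) \<le> 1 * norm (x - y)" by (intro r) auto
    then have "norm (f x - f y) \<le> norm (x - y) + norm (?D p (x - y))"
      using norm_triangle_ineq[of "f x - f y - ?D p (x - y)" "?D p (x - y)"] by simp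
    then show "dist (f x) (f y) \<le> (1 + B) * dist x y"
      using B(2)[of "x - y"] by (simp add: dist_norm algebra_simps)
  qed (use B in auto)
  with r(1) show "\<exists>e>0. \<exists>L. L-lipschitz_on (ball p e) f" by blast
qed

text \<open>On the ball \<open>K\<close> both factors are bounded and Lipschitz, and away from the
  support the product vanishes. The remaining pairs are at distance at least 1, where boundedness of
  the product suffices.\<close>

lemma bump_scaleR_lipschitz:
  fixes g :: "'a::euclidean_space \<Rightarrow> 'b::real_normed_vector"
  assumes g: "locally_lipschitz g"
  obtains C B L where "\<And>x y. norm (bump n x *\<^sub>R g x - bump n y *\<^sub>R g y) \<le> C * norm (x - y)"
    and "\<And>x. norm (bump n x *\<^sub>R g x) \<le> B"
    and "\<And>x y. bump n x \<noteq> 0 \<Longrightarrow> norm (y - x) \<le> 1 \<Longrightarrow> norm (g y - g x) \<le> L * norm (y - x)"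
proof -
  \<comment> \<open>The margin of 1 around the support serves the pairs in \<open>in_out\<close> and
    the points \<open>y\<close> within distance 1 of \<open>x\<close>.\<close>
  define K where "K = cball (0::'a) (real n + 2)"
  let ?b = "bump n :: 'a \<Rightarrow> real"
  have K: "compact K" by (simp add: K_def)
  obtain L where L: "L-lipschitz_on K g"
    using locally_lipschitz_on_compact[OF g K] .
  obtain A where A: "A-lipschitz_on K ?b"
    using locally_lipschitz_on_compact[OF Ck_on_1_imp_locally_lipschitz[OF Ck_on_bump] K] .
  have "bounded (g ` K)"
    using lipschitz_on_continuous_on[OF L] K compact_continuous_image compact_imp_bounded by blast
  then obtain B where B: "B > 0" "\<And>x. x \<in> K \<Longrightarrow> norm (g x) \<le> B"
    by (auto simp: bounded_pos)
  have AL: "A \<ge> 0" "L \<ge> 0" using A L lipschitz_on_nonneg by auto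
  \<comment> \<open>A B + L comes from the product rule inside \<open>K\<close>, the last B from the
    pairs in \<open>in_out\<close>.\<close>
  define C where "C = A * B + L + B"
  have C: "C \<ge> 0" using AL B by (simp add: C_def)
  have bd: "norm (?b x *\<^sub>R g x) \<le> B" for x
  proof (cases "x \<in> K")
    case True
    then show ?thesis
      using mult_mono[OF bump_le_1[of n x] B(2)[OF True]] by (simp add: bump_nonneg)
  next
    case False
    then show ?thesis using B bump_eq_0_outside[of n x] by (simp add: K_def)
  qed
  have lip: "norm (?b x *\<^sub>R g x - ?b y *\<^sub>R g y) \<le> C * norm (x - y)" for x y
  proof -
    have in_out: "norm (?b x *\<^sub>R g x - ?b y *\<^sub>R g y) \<le> C * norm (x - y)"
      if "norm x \<le> real n + 1" "norm y \<ge> real n + 2" for x y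
    proof -
      have "norm (x - y) \<ge> 1" using that norm_triangle_ineq2[of y x] by (simp add: norm_minus_commute)
      have "norm (?b x *\<^sub>R g x - ?b y *\<^sub>R g y) \<le> B"
        using bump_eq_0_outside[of n y] that bd[of x] by simp
      also have "\<dots> \<le> C * 1" using AL B by (simp add: C_def)
      also have "\<dots> \<le> C * norm (x - y)" using \<open>norm (x - y) \<ge> 1\<close> C by (rule mult_left_mono)
      finally show ?thesis .
    qed
    consider "x \<in> K" "y \<in> K" | "norm x \<ge> real n + 1" "norm y \<ge> real n + 1"
      | "norm x \<le> real n + 1" "norm y \<ge> real n + 2" | "norm y \<le> real n + 1" "norm x \<ge> real n + 2"
      unfolding K_def by fastforce
    then show ?thesis
    proof cases
      case 1
      have "norm ((?b x - ?b y) *\<^sub>R g x) \<le> (A * norm (x - y)) * B"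
        unfolding norm_scaleR
        using lipschitz_onD[OF A 1] AL B(2)[OF 1(1)] by (intro mult_mono) (auto simp: dist_norm)
      moreover have "norm (?b y *\<^sub>R (g x - g y)) \<le> 1 * (L * norm (x - y))"
        unfolding norm_scaleR
        using lipschitz_onD[OF L 1] bump_nonneg[of n y] bump_le_1[of n y] by (intro mult_mono) (auto simp: dist_norm)
      moreover have "?b x *\<^sub>R g x - ?b y *\<^sub>R g y = (?b x - ?b y) *\<^sub>R g x + ?b y *\<^sub>R (g x - g y)"
        by (simp add: algebra_simps)
      ultimately have "norm (?b x *\<^sub>R g x - ?b y *\<^sub>R g y) \<le> A * norm (x - y) * B + L * norm (x - y)"
        using norm_triangle_ineq[of "(?b x - ?b y) *\<^sub>R g x" "?b y *\<^sub>R (g x - g y)"] by simp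
      also have "\<dots> \<le> C * norm (x - y)" using B by (simp add: C_def algebra_simps)
      finally show ?thesis .
    next
      case 2
      then show ?thesis using bump_eq_0_outside[of n x] bump_eq_0_outside[of n y] C by simp
    next
      case 3
      then show ?thesis by (rule in_out)
    next
      case 4
      from in_out[OF this] show ?thesis by (simp add: norm_minus_commute)
    qed
  qed
  have "norm (g y - g x) \<le> L * norm (y - x)" if "?b x \<noteq> 0" "norm (y - x) \<le> 1" for x y
  proof -
    have "norm x < real n + 1" using bump_eq_0_outside[of n x] that(1) by fastforce
    then have "x \<in> K" "y \<in> K" using that(2) norm_triangle_ineq2[of y x] by (auto simp: K_def)
    then show ?thesis using lipschitz_onD[OF L, of y x] by (simp add: dist_norm)
  qed
  with lip bd that show ?thesis by blast
qed

text \<open>\<open>D\<close> is the sum of the four demands 1 / \<delta>, 2 |C|, |B| and |L| /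
  \<kappa>, and c = w / D meets all of them. Here \<open>w\<close> stands for the share of each
  bound allotted to one bump.\<close>

lemma exists_small_coefficient:
  fixes w \<delta> \<kappa> C B L :: real
  assumes "w > 0" "\<delta> > 0" "\<kappa> > 0"
  shows "\<exists>c>0. c \<le> w * \<delta> \<and> c * C \<le> w * (1/2) \<and> c * B \<le> w * 1 \<and> c * L \<le> w * \<kappa>"
proof -
  define D where "D = 1 / \<delta> + 2 * \<bar>C\<bar> + \<bar>B\<bar> + \<bar>L\<bar> / \<kappa>"
  have D: "D > 0" using assms by (simp add: D_def add_pos_nonneg)
  have le: "w / D * X \<le> w * Y" if "X \<le> Y * D" for X Y
  proof -
    have "w * X \<le> w * (Y * D)" using that assms(1) by (intro mult_left_mono) auto
    then show ?thesis using D by (simp add: divide_simps)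
  qed
  have nn: "0 \<le> \<bar>L\<bar> / \<kappa>" "0 < 1 / \<delta>" using assms by auto
  have "\<delta> * (1 / \<delta>) \<le> \<delta> * D" "\<kappa> * (\<bar>L\<bar> / \<kappa>) \<le> \<kappa> * D" 
    using assms nn by (intro mult_left_mono; simp add: D_def)+
  then have "1 \<le> \<delta> * D" "L \<le> \<kappa> * D" using assms by auto
  moreover have "2 * \<bar>C\<bar> \<le> D" "\<bar>B\<bar> \<le> D" using nn by (simp_all add: D_def)
  then have "C \<le> 1/2 * D" "B \<le> 1 * D"
    using abs_ge_self[of C] abs_ge_self[of B] by simp_all
  ultimately show ?thesis
    using le[of 1 \<delta>] le[of C "1/2"] le[of B 1] le[of L \<kappa>] D assms(1) by (intro exI[of _ "w / D"]) auto
qed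

text \<open>\<open>h\<close> is the series of \<open>c n * bump n\<close>, with \<open>c n\<close>
  so small that term \<open>n\<close> uses at most the share \<open>w n\<close> of every bound. The
  shares sum to at most 1, so the triangle inequality gives the bounds for \<open>h\<close>; growth
  of \<open>g\<close> at infinity is absorbed by the coefficients.\<close>

lemma exists_smooth_step_size:
  fixes g :: "'a::euclidean_space \<Rightarrow> 'b::real_normed_vector"
  assumes g: "locally_lipschitz g" and "\<delta> > 0" "\<kappa> > 0"
  obtains h :: "'a \<Rightarrow> real" where "smooth_on h UNIV" "\<And>x. 0 < h x" "\<And>x. h x \<le> \<delta>"
    and "\<And>x y. norm (h x *\<^sub>R g x - h y *\<^sub>R g y) \<le> 1 / 2 * norm (x - y)"
    and "\<And>x. norm (h x *\<^sub>R g x) \<le> 1"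
    and "\<And>x y. norm (y - x) \<le> 1 \<Longrightarrow> h x * norm (g y - g x) \<le> \<kappa> * norm (y - x)"
proof -
  define w :: "nat \<Rightarrow> real" where "w n = (1/2) ^ Suc n" for n
  have w: "w n > 0" for n by (simp add: w_def)
  have w_sum: "(\<Sum>n<M. w n) \<le> 1" for M
  proof -
    have "(\<Sum>n<M. w n) = 1 - (1/2) ^ M" by (induction M) (simp_all add: w_def)
    then show ?thesis by simp
  qed
  have "\<forall>n. \<exists>c>0. c \<le> w n * \<delta> \<and>
      (\<forall>x y. c * norm (bump n x *\<^sub>R g x - bump n y *\<^sub>R g y) \<le> w n * (1/2 * norm (x - y))) \<and>
      (\<forall>x. c * norm (bump n x *\<^sub>R g x) \<le> w n * 1) \<and>
      (\<forall>x y. bump n x \<noteq> 0 \<longrightarrow> norm (y - x) \<le> 1 \<longrightarrow> c * norm (g y - g x) \<le> w n * (\<kappa> * norm (y - x)))"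
  proof
    fix n
    obtain C B L where CBL: "\<And>x y. norm (bump n x *\<^sub>R g x - bump n y *\<^sub>R g y) \<le> C * norm (x - y)"
      "\<And>x. norm (bump n x *\<^sub>R g x) \<le> B"
      "\<And>x y. bump n x \<noteq> 0 \<Longrightarrow> norm (y - x) \<le> 1 \<Longrightarrow> norm (g y - g x) \<le> L * norm (y - x)"
      using bump_scaleR_lipschitz[OF g, of n] by blast
    obtain c where c: "c > 0" "c \<le> w n * \<delta>" "c * C \<le> w n * (1/2)" "c * B \<le> w n * 1" "c * L \<le> w n * \<kappa>"
      using exists_small_coefficient[OF w assms(2,3), of n C B L] by blast
    have scale: "c * X \<le> w n * (Y * Z)" if "X \<le> D * Z" "c * D \<le> w n * Y" "Z \<ge> 0" for X D Y Z
      using mult_left_mono[OF that(1), of c] mult_right_mono[OF that(2,3)] c(1)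
      unfolding mult.assoc by linarith
    show "\<exists>c>0. c \<le> w n * \<delta> \<and>
      (\<forall>x y. c * norm (bump n x *\<^sub>R g x - bump n y *\<^sub>R g y) \<le> w n * (1/2 * norm (x - y))) \<and>
      (\<forall>x. c * norm (bump n x *\<^sub>R g x) \<le> w n * 1) \<and>
      (\<forall>x y. bump n x \<noteq> 0 \<longrightarrow> norm (y - x) \<le> 1 \<longrightarrow> c * norm (g y - g x) \<le> w n * (\<kappa> * norm (y - x)))"
    proof (intro exI[of _ c] conjI allI impI)
      show "c * norm (bump n x *\<^sub>R g x) \<le> w n * 1" for x
        using mult_left_mono[OF CBL(2)[of x], of c] c(1,4) by linarith
      show "c * norm (bump n x *\<^sub>R g x - bump n y *\<^sub>R g y) \<le> w n * (1/2 * norm (x - y))" for x y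
        by (rule scale[OF CBL(1) c(3)]) simp
      show "c * norm (g y - g x) \<le> w n * (\<kappa> * norm (y - x))"
        if "bump n x \<noteq> 0" "norm (y - x) \<le> 1" for x y
        by (rule scale[OF CBL(3)[OF that] c(5)]) simp
    qed (use c in auto)
  qed
  then obtain c where c: "\<And>n. c n > 0" "\<And>n. c n \<le> w n * \<delta>"
    "\<And>n x y. c n * norm (bump n x *\<^sub>R g x - bump n y *\<^sub>R g y) \<le> w n * (1/2 * norm (x - y))"
    "\<And>n x. c n * norm (bump n x *\<^sub>R g x) \<le> w n * 1"
    "\<And>n x y. bump n x \<noteq> 0 \<Longrightarrow> norm (y - x) \<le> 1 \<Longrightarrow> c n * norm (g y - g x) \<le> w n * (\<kappa> * norm (y - x))"
    by metis
  \<comment> \<open>At \<open>x\<close> all bumps of index at least x . x + 1 vanish, so a finite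
    sum replaces the series; \<open>h_eq\<close> permits any larger cutoff, in particular a common
    one for two points.\<close>
  define N where "N x = nat \<lceil>x \<bullet> x + 1\<rceil>" for x :: 'a
  define h where "h x = (\<Sum>n<N x. c n * bump n x)" for x
  have h_eq: "h x = (\<Sum>n<M. c n * bump n x)" if "x \<bullet> x + 1 \<le> real M" for x M
    unfolding h_def
  proof (rule sum.mono_neutral_left)
    show "{..<N x} \<subseteq> {..<M}" unfolding N_def lessThan_subset_iff using that by linarith
    show "\<forall>n\<in>{..<M} - {..<N x}. c n * bump n x = 0"
    proof
      fix n assume "n \<in> {..<M} - {..<N x}"
      then have "x \<bullet> x + 1 \<le> real n" unfolding N_def by simp linarith
      then have "bump n x = 0" unfolding bump_eq_0_iff by linarith
      then show "c n * bump n x = 0" by simp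
    qed
  qed simp
  have bound: "(\<Sum>n<M. X n) \<le> Y" if "\<And>n. X n \<le> w n * Y" "Y \<ge> 0" for X M Y
  proof -
    have "(\<Sum>n<M. X n) \<le> (\<Sum>n<M. w n) * Y" unfolding sum_distrib_right by (intro sum_mono that)
    also have "\<dots> \<le> 1 * Y" by (intro mult_right_mono w_sum that)
    finally show ?thesis by simp
  qed
  have cb: "c n * bump n x \<ge> 0" for n x using c(1)[of n] bump_nonneg[of n x] by simp
  have NM: "x \<bullet> x + 1 \<le> real (N x)" for x unfolding N_def by linarith
  show thesis
  proof
    show "smooth_on h UNIV" using h_eq by (rule smooth_on_bump_series)
    show "0 < h x" for x
    proof -
      obtain n where n: "bump n x > 0" using bump_pos_ex by blast
      \<comment> \<open>The cutoff is raised so that the sum surely contains the bump that is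
        positive at \<open>x\<close>.\<close>
      define M where "M = max (Suc n) (N x)"
      have "h x = (\<Sum>n<M. c n * bump n x)" using NM[of x] by (intro h_eq) (auto simp: M_def)
      moreover have "0 < c n * bump n x" using n c(1) by simp
      moreover have "c n * bump n x \<le> (\<Sum>n<M. c n * bump n x)"
        by (rule member_le_sum) (use cb in \<open>auto simp: M_def\<close>)
      ultimately show ?thesis by simp
    qed
    show "h x \<le> \<delta>" for x
      unfolding h_def
    proof (rule bound)
      show "c n * bump n x \<le> w n * \<delta>" for n
        using mult_mono[OF c(2)[of n] bump_le_1[of n x]] w[of n] assms(2) bump_nonneg[of n x] by simp
    qed (use assms in simp)
    show "norm (h x *\<^sub>R g x - h y *\<^sub>R g y) \<le> 1 / 2 * norm (x - y)" for x y
    proof -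
      define M where "M = max (N x) (N y)"
      have "h x *\<^sub>R g x - h y *\<^sub>R g y = (\<Sum>n<M. c n *\<^sub>R (bump n x *\<^sub>R g x - bump n y *\<^sub>R g y))"
        using h_eq[of x M] h_eq[of y M] NM[of x] NM[of y]
        by (simp add: M_def scaleR_sum_left sum_subtractf scaleR_diff_right)
      then have "norm (h x *\<^sub>R g x - h y *\<^sub>R g y) \<le>
          (\<Sum>n<M. norm (c n *\<^sub>R (bump n x *\<^sub>R g x - bump n y *\<^sub>R g y)))"
        using norm_sum[of "\<lambda>n. c n *\<^sub>R (bump n x *\<^sub>R g x - bump n y *\<^sub>R g y)" "{..<M}"] by (simp only:)
      also have "\<dots> \<le> 1 / 2 * norm (x - y)"
      proof (rule bound)
        show "norm (c n *\<^sub>R (bump n x *\<^sub>R g x - bump n y *\<^sub>R g y)) \<le> w n * (1 / 2 * norm (x - y))" for n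
          using c(3)[of n x y] c(1)[of n] by simp
      qed simp
      finally show ?thesis .
    qed
    show "norm (h x *\<^sub>R g x) \<le> 1" for x
    proof -
      have "norm (h x *\<^sub>R g x) \<le> (\<Sum>n<N x. norm (c n *\<^sub>R (bump n x *\<^sub>R g x)))"
        using norm_sum[of "\<lambda>n. c n *\<^sub>R (bump n x *\<^sub>R g x)" "{..<N x}"]
        by (simp add: h_def scaleR_sum_left)
      also have "\<dots> \<le> 1"
      proof (rule bound)
        show "norm (c n *\<^sub>R (bump n x *\<^sub>R g x)) \<le> w n * 1" for n
          using c(4)[of n x] c(1)[of n] by (simp add: abs_mult mult.assoc)
      qed simp
      finally show ?thesis .
    qed
    show "h x * norm (g y - g x) \<le> \<kappa> * norm (y - x)" if "norm (y - x) \<le> 1" for x y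
      unfolding h_def sum_distrib_right
    proof (rule bound)
      show "c n * bump n x * norm (g y - g x) \<le> w n * (\<kappa> * norm (y - x))" for n
      proof (cases "bump n x = 0")
        case False
        have "bump n x * (c n * norm (g y - g x)) \<le> 1 * (c n * norm (g y - g x))"
          using c(1)[of n] bump_le_1[of n x] by (intro mult_right_mono) auto
        also have "\<dots> \<le> w n * (\<kappa> * norm (y - x))" using c(5)[OF False that] by simp
        finally show ?thesis by (simp add: mult_ac)
      qed (use w[of n] assms in simp)
    qed (use assms in simp)
  qed
qed

text \<open>By the mean value theorem the change of \<open>f\<close> is - (s g x) . g y for some
  \<open>y\<close> on the step. Replacing \<open>g y\<close> by \<open>g x\<close> costs at most
  \<kappa> s |g x|^2 by \<open>lip\<close>, which applies because the step has length at most
  1.\<close>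

lemma gradient_step_descent:
  fixes f :: "'a::euclidean_space \<Rightarrow> real"
  assumes f: "\<And>x. GDERIV f x :> g x" and "s \<ge> 0" and "norm (s *\<^sub>R g x) \<le> 1"
    and lip: "\<And>y. norm (y - x) \<le> 1 \<Longrightarrow> s * norm (g y - g x) \<le> \<kappa> * norm (y - x)" and "\<kappa> \<ge> 0"
  shows "f (x - s *\<^sub>R g x) - f x \<le> - (1 - \<kappa>) * s * (norm (g x))\<^sup>2"
proof -
  let ?v = "s *\<^sub>R g x"
  have "((\<lambda>t. f (x - t *\<^sub>R ?v)) has_real_derivative - (?v \<bullet> g (x - t *\<^sub>R ?v))) (at t)" for t
  proof -
    have "((\<lambda>t. x - t *\<^sub>R ?v) has_derivative (\<lambda>t. - (t *\<^sub>R ?v))) (at t)"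
      by (auto intro!: derivative_eq_intros)
    from has_derivative_compose[OF this f[unfolded gderiv_def]] show ?thesis
      unfolding has_field_derivative_def by (rule has_derivative_eq_rhs) (simp add: fun_eq_iff)
  qed
  then obtain t where t: "0 < t" "t < 1" "f (x - ?v) - f x = - (?v \<bullet> g (x - t *\<^sub>R ?v))"
    using MVT2[of 0 1 "\<lambda>t. f (x - t *\<^sub>R ?v)" "\<lambda>t. - (?v \<bullet> g (x - t *\<^sub>R ?v))"] by auto
  define y where "y = x - t *\<^sub>R ?v"
  have yx: "norm (y - x) \<le> norm ?v"
    using t mult_right_mono[of t 1 "norm ?v"] by (simp add: y_def abs_mult mult.assoc)
  have "s * norm (g y - g x) \<le> \<kappa> * norm ?v"
    using lip[of y] yx assms(3) mult_left_mono[OF yx \<open>\<kappa> \<ge> 0\<close>] by linarith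
  have "- (?v \<bullet> (g y - g x)) \<le> norm (g x) * (s * norm (g y - g x))"
    using Cauchy_Schwarz_ineq2[of ?v "g y - g x"] \<open>s \<ge> 0\<close> by (simp add: mult_ac)
  also have "\<dots> \<le> norm (g x) * (\<kappa> * norm ?v)" by (intro mult_left_mono) (fact, simp)
  finally have "- (?v \<bullet> (g y - g x)) \<le> \<kappa> * s * (norm (g x))\<^sup>2"
    using \<open>s \<ge> 0\<close> by (simp add: power2_eq_square mult_ac)
  moreover have "?v \<bullet> g x = s * (norm (g x))\<^sup>2" by (simp add: dot_square_norm)
  moreover have "f (x - ?v) - f x = - (?v \<bullet> (g y - g x)) - ?v \<bullet> g x"
    using t(3) unfolding y_def[symmetric] by (simp add: inner_diff_right right_diff_distrib)
  moreover have "- (1 - \<kappa>) * s * (norm (g x))\<^sup>2 = \<kappa> * s * (norm (g x))\<^sup>2 - s * (norm (g x))\<^sup>2"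
    by (simp add: algebra_simps)
  ultimately show ?thesis by linarith
qed

section \<open>Sequences with vanishing steps\<close>

lemma cluster_point_if_subseq_bounded:
  fixes x :: "nat \<Rightarrow> 'a::heine_borel" and r :: "nat \<Rightarrow> nat"
  assumes "strict_mono r" and "bounded (range (x \<circ> r))"
  obtains s p where "strict_mono s" "((x \<circ> r) \<circ> s) \<longlonglongrightarrow> p" "cluster_point x p"
proof -
  obtain p s where "strict_mono s" "((x \<circ> r) \<circ> s) \<longlonglongrightarrow> p"
    using bounded_imp_convergent_subsequence[OF assms(2)] by blast
  moreover from this have "cluster_point x p"
    using strict_mono_o[OF assms(1), of s] by (auto simp: cluster_point_def comp_assoc intro!: exI[of _ "r \<circ> s"])
  ultimately show ?thesis using that by blast
qed

text \<open>Norms that do not tend to infinity stay below some bound infinitely often, and a bounded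
  subsequence has a cluster point.\<close>

lemma cluster_point_if_not_diverging:
  fixes x :: "nat \<Rightarrow> 'a::{heine_borel, real_normed_vector}"
  assumes "\<not> filterlim (\<lambda>n. norm (x n)) at_top sequentially"
  obtains p where "cluster_point x p"
proof -
  obtain B where "\<exists>\<^sub>F n in sequentially. \<not> B \<le> norm (x n)"
    using assms by (auto simp: filterlim_at_top not_eventually)
  then have "infinite {n. norm (x n) < B}"
    by (simp add: frequently_cofinite[symmetric] cofinite_eq_sequentially not_le)
  then obtain r :: "nat \<Rightarrow> nat" where "strict_mono r" "\<And>n. norm (x (r n)) < B"
    using infinite_enumerate by blast
  then have "bounded (range (x \<circ> r))"
    by (auto simp: bounded_iff intro!: exI[of _ B] less_imp_le)
  from cluster_point_if_subseq_bounded[OF \<open>strict_mono r\<close> this] that show ?thesis by blast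
qed

lemma frequently_close_to_cluster_point:
  fixes x :: "nat \<Rightarrow> 'a::metric_space"
  assumes "cluster_point x p" "e > 0"
  shows "\<exists>n\<ge>N. dist (x n) p < e"
proof -
  obtain r where r: "strict_mono r" "(x \<circ> r) \<longlonglongrightarrow> p"
    using assms(1) unfolding cluster_point_def by blast
  then obtain M where "\<And>n. n \<ge> M \<Longrightarrow> dist (x (r n)) p < e"
    using metric_LIMSEQ_D[OF r(2) assms(2)] by auto
  moreover have "N \<le> r (max M N)"
    using strict_mono_imp_increasing[OF r(1), of "max M N"] by linarith
  ultimately show ?thesis by (meson max.cobounded1)
qed

text \<open>The distance to \<open>p\<close> is infinitely often near \<open>0\<close> and infinitely often at least \<open>r\<close>; as the steps
  tend to \<open>0\<close>, it cannot jump over an intermediate value \<open>t\<close>.\<close>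

lemma cluster_points_at_small_distances:
  fixes x :: "nat \<Rightarrow> 'a::{heine_borel, real_normed_vector}"
  assumes steps: "(\<lambda>n. norm (x (Suc n) - x n)) \<longlonglongrightarrow> 0"
    and p: "cluster_point x p" and "\<not> x \<longlonglongrightarrow> p"
  obtains r where "r > 0" "\<And>t. 0 < t \<Longrightarrow> t < r \<Longrightarrow> \<exists>q. cluster_point x q \<and> dist q p = t"
proof -
  obtain r where r: "r > 0" "\<And>N. \<exists>n\<ge>N. dist (x n) p \<ge> r"
    using assms(3) unfolding LIMSEQ_def by (meson not_less)
  have "\<exists>q. cluster_point x q \<and> dist q p = t" if t: "0 < t" "t < r" for t
  proof -
    have near: "\<exists>n\<ge>N. \<bar>dist (x n) p - t\<bar> < e" if "e > 0" for N e
    proof -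
      obtain N1 where N1: "\<And>n. n \<ge> N1 \<Longrightarrow> norm (x (Suc n) - x n) < e"
        using LIMSEQ_D[OF steps \<open>e > 0\<close>] by auto
      obtain n0 where n0: "n0 \<ge> max N N1" "dist (x n0) p < t"
        using frequently_close_to_cluster_point[OF p t(1)] by blast
      obtain n1 where n1: "n1 \<ge> n0" "dist (x n1) p \<ge> t" using r(2)[of n0] t by force
      \<comment> \<open>The first time after the visit near \<open>p\<close> at which the distance
        reaches \<open>t\<close>. The distance just before is below \<open>t\<close>, so the
        overshoot is less than one step, hence below \<open>e\<close>.\<close>
      define n where "n = (LEAST n. n \<ge> n0 \<and> dist (x n) p \<ge> t)"
      have n: "n \<ge> n0" "dist (x n) p \<ge> t"
        using LeastI[of "\<lambda>n. n \<ge> n0 \<and> dist (x n) p \<ge> t" n1] n1 by (auto simp: n_def)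
      then have "n \<noteq> n0" using n0 by auto
      with n(1) obtain m where m: "n = Suc m" "m \<ge> n0" by (cases n) auto
      then have "dist (x m) p < t"
        using not_less_Least[of m "\<lambda>n. n \<ge> n0 \<and> dist (x n) p \<ge> t"] by (auto simp: n_def[symmetric])
      moreover have "dist (x (Suc m)) (x m) < e" using N1[of m] m n0 by (simp add: dist_norm)
      ultimately have "dist (x n) p < t + e"
        using dist_triangle[of "x (Suc m)" p "x m"] by (simp add: m(1))
      with n that n0 show ?thesis by (intro exI[of _ n]) auto
    qed
    \<comment> \<open>A subsequence along which the distance tends to \<open>t\<close>; it is
      bounded, so it has a cluster point, which lies at distance exactly \<open>t\<close>.\<close>
    have "\<exists>s. \<forall>k. \<bar>dist (x (s k)) p - t\<bar> < inverse (real (Suc k)) \<and> s k < s (Suc k)"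
    proof (rule dependent_nat_choice)
      show "\<exists>n. \<bar>dist (x n) p - t\<bar> < inverse (real (Suc 0))" using near[of 1 0] by auto
      show "\<exists>m. \<bar>dist (x m) p - t\<bar> < inverse (real (Suc (Suc k))) \<and> n < m" for n k
        using near[of "inverse (real (Suc (Suc k)))" "Suc n"] by (metis Suc_le_lessD inverse_positive_iff_positive of_nat_0_less_iff zero_less_Suc)
    qed
    then obtain s where s: "\<And>k. \<bar>dist (x (s k)) p - t\<bar> < inverse (real (Suc k))" "strict_mono s"
      by (auto simp: strict_mono_Suc_iff)
    have lim: "(\<lambda>k. dist (x (s k)) p) \<longlonglongrightarrow> t"
    proof (rule LIM_zero_cancel, rule Lim_null_comparison)
      show "\<forall>\<^sub>F k in sequentially. norm (dist (x (s k)) p - t) \<le> inverse (real (Suc k))"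
        using s(1) by (auto intro: always_eventually less_imp_le)
    qed (rule LIMSEQ_inverse_real_of_nat)
    have "dist p (x (s k)) \<le> t + 1" for k
    proof -
      have "inverse (real (Suc k)) \<le> 1" by (simp add: inverse_eq_divide)
      then show ?thesis using s(1)[of k] by (simp add: dist_commute[of p])
    qed
    then have "bounded (range (x \<circ> s))"
      unfolding bounded_any_center[where a = p] by auto
    from cluster_point_if_subseq_bounded[OF s(2) this]
    obtain u q where u: "strict_mono u" "((x \<circ> s) \<circ> u) \<longlonglongrightarrow> q" "cluster_point x q" by blast
    have "(\<lambda>k. dist (((x \<circ> s) \<circ> u) k) p) \<longlonglongrightarrow> dist q p" by (intro tendsto_dist u tendsto_const)
    moreover have "(\<lambda>k. dist (((x \<circ> s) \<circ> u) k) p) \<longlonglongrightarrow> t"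
      using LIMSEQ_subseq_LIMSEQ[OF lim u(1)] by (simp add: o_def)
    ultimately show ?thesis using u(3) LIMSEQ_unique by blast
  qed
  with r(1) that show ?thesis by blast
qed

text \<open>Otherwise the distances from \<open>p\<close> to the cluster points would cover an open
  interval, which is uncountable.\<close>

lemma converges_if_countable_cluster_points:
  fixes x :: "nat \<Rightarrow> 'a::{heine_borel, real_normed_vector}"
  assumes "(\<lambda>n. norm (x (Suc n) - x n)) \<longlonglongrightarrow> 0" "cluster_point x p" and "countable {q. cluster_point x q}"
  shows "x \<longlonglongrightarrow> p"
proof (rule ccontr)
  assume "\<not> x \<longlonglongrightarrow> p"
  then obtain r where r: "r > 0" "\<And>t. 0 < t \<Longrightarrow> t < r \<Longrightarrow> \<exists>q. cluster_point x q \<and> dist q p = t"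
    using cluster_points_at_small_distances[OF assms(1,2)] by blast
  have "{0<..<r} \<subseteq> (\<lambda>q. dist q p) ` {q. cluster_point x q}"
    using r(2) by (auto simp: image_iff) metis
  then have "countable {0<..<r}" using assms(3) by (meson countable_image countable_subset)
  then show False using uncountable_open_interval[of 0 r] r(1) by simp
qed

text \<open>Otherwise there are cluster points, all in \<open>C\<close>, at every small positive
  distance from \<open>p\<close>.\<close>

lemma converges_if_isolated_cluster_point:
  fixes x :: "nat \<Rightarrow> 'a::{heine_borel, real_normed_vector}"
  assumes "(\<lambda>n. norm (x (Suc n) - x n)) \<longlonglongrightarrow> 0" "cluster_point x p"
    and "p isolated_in C" and "\<And>q. cluster_point x q \<Longrightarrow> q \<in> C"
  shows "x \<longlonglongrightarrow> p"
proof (rule ccontr)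
  assume "\<not> x \<longlonglongrightarrow> p"
  then obtain r where r: "r > 0" "\<And>t. 0 < t \<Longrightarrow> t < r \<Longrightarrow> \<exists>q. cluster_point x q \<and> dist q p = t"
    using cluster_points_at_small_distances[OF assms(1,2)] by blast
  obtain e where e: "e > 0" "\<And>q. q \<in> C \<Longrightarrow> dist p q < e \<Longrightarrow> q = p"
    using assms(3) unfolding isolated_in_dist_Ex_iff by blast
  have "0 < min r e / 2" "min r e / 2 < r" "min r e / 2 < e" using r(1) e(1) by linarith+
  moreover from this r(2) obtain q where q: "cluster_point x q" "dist q p = min r e / 2" by blast
  ultimately have "q = p" using e(2)[of q] assms(4)[of q] by (simp add: dist_commute)
  with q(2) \<open>0 < min r e / 2\<close> show False by simp
qed

text \<open>A cluster point \<open>p\<close> makes \<open>f p\<close> a lower bound of the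
  decreasing values \<open>f (x n)\<close>; these converge, and \<open>descent\<close> forces the
  steps to 0. Excluding cluster points in the second alternative allows vanishing steps to be
  inferred from any cluster point.\<close>

lemma descent_sequence_dichotomy:
  fixes f :: "'a::{heine_borel, real_normed_vector} \<Rightarrow> real"
  assumes cont: "continuous_on UNIV f" and "c > 0"
    and descent: "\<And>n. c * (norm (x (Suc n) - x n))\<^sup>2 \<le> f (x n) - f (x (Suc n))"
  shows "(\<lambda>n. norm (x (Suc n) - x n)) \<longlonglongrightarrow> 0 \<or>
    filterlim (\<lambda>n. norm (x n)) at_top sequentially \<and> (\<forall>p. \<not> cluster_point x p)"
proof -
  have "f (x (Suc n)) \<le> f (x n)" for n
    using descent[of n] zero_le_power2[of "norm (x (Suc n) - x n)"] \<open>c > 0\<close>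
    by (smt (verit) mult_nonneg_nonneg)
  then have dec: "decseq (\<lambda>n. f (x n))" by (intro decseq_SucI)
  show ?thesis
  proof (cases "\<exists>p. cluster_point x p")
    case True
    then obtain p r where r: "strict_mono r" "(x \<circ> r) \<longlonglongrightarrow> p" by (auto simp: cluster_point_def)
    have "(\<lambda>n. f ((x \<circ> r) n)) \<longlonglongrightarrow> f p"
      by (rule isCont_tendsto_compose[OF _ r(2)]) (use cont in \<open>simp add: continuous_on_eq_continuous_at\<close>)
  moreover have "decseq (\<lambda>n. f ((x \<circ> r) n))"
      using dec r(1) by (auto simp: decseq_def strict_mono_less_eq)
    ultimately have lb: "f p \<le> f ((x \<circ> r) n)" for n
      using decseq_ge[of "\<lambda>n. f ((x \<circ> r) n)" "f p" n] by simp
    have "f p \<le> f (x n)" for n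
      using lb[of n] decseqD[OF dec, of n "r n"] strict_mono_imp_increasing[OF r(1), of n] by simp
    then obtain l where l: "(\<lambda>n. f (x n)) \<longlonglongrightarrow> l" using decseq_convergent[OF dec] by blast
    have "(\<lambda>n. (f (x n) - f (x (Suc n))) / c) \<longlonglongrightarrow> (l - l) / c"
      by (intro tendsto_intros l LIMSEQ_Suc[OF l]) (use \<open>c > 0\<close> in auto)
    then have "(\<lambda>n. (f (x n) - f (x (Suc n))) / c) \<longlonglongrightarrow> 0" by simp
    then have "(\<lambda>n. (norm (x (Suc n) - x n))\<^sup>2) \<longlonglongrightarrow> 0"
      by (rule Lim_null_comparison[rotated])
        (use descent \<open>c > 0\<close> in \<open>auto simp: pos_le_divide_eq mult.commute intro!: always_eventually\<close>)
    from tendsto_real_sqrt[OF this] show ?thesis by auto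
  next
    case False
    then show ?thesis using cluster_point_if_not_diverging by blast
  qed
qed

lemma cluster_point_step_zero:
  fixes F :: "'a::real_normed_vector \<Rightarrow> 'a"
  assumes "continuous_on UNIV F" "\<And>n. x (Suc n) = x n - F (x n)"
    and "(\<lambda>n. norm (x (Suc n) - x n)) \<longlonglongrightarrow> 0" and "cluster_point x p"
  shows "F p = 0"
proof -
  obtain r where r: "strict_mono r" "(x \<circ> r) \<longlonglongrightarrow> p" using assms(4) by (auto simp: cluster_point_def)
  have "(\<lambda>n. F ((x \<circ> r) n)) \<longlonglongrightarrow> F p"
    by (rule isCont_tendsto_compose[OF _ r(2)]) (use assms(1) in \<open>simp add: continuous_on_eq_continuous_at\<close>)
  moreover have "(\<lambda>n. norm (F (x n))) \<longlonglongrightarrow> 0" using assms(3) by (simp add: assms(2))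
  then have "(\<lambda>n. F ((x \<circ> r) n)) \<longlonglongrightarrow> 0"
    using LIMSEQ_subseq_LIMSEQ[OF _ r(1), of "\<lambda>n. norm (F (x n))" 0]
    by (simp add: o_def tendsto_norm_zero_iff)
  ultimately show ?thesis by (rule LIMSEQ_unique)
qed

section \<open>Strict derivative of the step field at a critical point\<close>

text \<open>Since \<open>g p = 0\<close>, each variation of \<open>h\<close> is multiplied by a
  small value or difference of \<open>g\<close>, so only the Lipschitz constant of \<open>h\<close>
  enters and not its derivative.\<close>

lemma strict_derivative_scaleR_zero:
  fixes g :: "'a::euclidean_space \<Rightarrow> 'b::real_normed_vector"
  assumes "g p = 0" and M: "linear M" and h: "locally_lipschitz h"
    and strict: "\<And>\<epsilon>. \<epsilon> > 0 \<Longrightarrow> \<exists>r>0. \<forall>x\<in>cball p r. \<forall>y\<in>cball p r.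
        norm (g x - g y - M (x - y)) \<le> \<epsilon> * norm (x - y)"
    and "\<epsilon> > 0"
  shows "\<exists>r>0. \<forall>x\<in>cball p r. \<forall>y\<in>cball p r.
    norm (h x *\<^sub>R g x - h y *\<^sub>R g y - h p *\<^sub>R M (x - y)) \<le> \<epsilon> * norm (x - y)"
proof -
  obtain e K where e: "e > 0" "K-lipschitz_on (ball p e) h"
    using h unfolding locally_lipschitz_def by blast
  have K: "K \<ge> 0" using e(2) by (rule lipschitz_on_nonneg)
  obtain B where B: "B > 0" "\<And>v. norm (M v) \<le> B * norm v"
    using linear_bounded_pos[OF M] by blast
  \<comment> \<open>Half of \<epsilon> is spent on linearising \<open>g\<close>, the other half on
    the two terms that contain a variation of \<open>h\<close>.\<close>
  define \<eta> where "\<eta> = \<epsilon> / (2 * (\<bar>h p\<bar> + 1))"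
  have \<eta>: "\<eta> > 0" "\<bar>h p\<bar> * \<eta> \<le> \<epsilon> / 2" using \<open>\<epsilon> > 0\<close> by (auto simp: \<eta>_def field_simps)
  obtain r1 where r1: "r1 > 0" "\<And>x y. x \<in> cball p r1 \<Longrightarrow> y \<in> cball p r1 \<Longrightarrow>
      norm (g x - g y - M (x - y)) \<le> \<eta> * norm (x - y)"
    using strict[OF \<eta>(1)] by blast
  define A where "A = B + \<eta>"
  have A: "A > 0" using B \<eta> by (simp add: A_def)
  \<comment> \<open>The last bound yields 2 K r A <= \<epsilon> / 2; the summand 1 covers the case K
    = 0.\<close>
  define r where "r = min (min r1 (e / 2)) (\<epsilon> / (4 * K * A + 1))"
  have KA: "4 * K * A + 1 > 0" using K A by (simp add: add_nonneg_pos)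
  have r: "r > 0" "r \<le> r1" "r < e" using r1(1) e(1) \<open>\<epsilon> > 0\<close> KA by (auto simp: r_def)
  have "r * (4 * K * A + 1) \<le> \<epsilon>"
    using KA min.cobounded2[of "min r1 (e / 2)" "\<epsilon> / (4 * K * A + 1)"]
    unfolding r_def[symmetric] by (simp add: pos_le_divide_eq)
  then have rK: "2 * (K * r * A) \<le> \<epsilon> / 2" using r(1) by (simp add: algebra_simps)
  have g_lip: "norm (g x - g y) \<le> A * norm (x - y)" if "x \<in> cball p r" "y \<in> cball p r" for x y
  proof -
    have "norm (g x - g y - M (x - y)) \<le> \<eta> * norm (x - y)" using that r(2) by (intro r1) auto
    then show ?thesis
      using norm_triangle_ineq[of "g x - g y - M (x - y)" "M (x - y)"] B(2)[of "x - y"]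
      by (simp add: A_def algebra_simps)
  qed
  have "norm (h x *\<^sub>R g x - h y *\<^sub>R g y - h p *\<^sub>R M (x - y)) \<le> \<epsilon> * norm (x - y)"
    if x: "x \<in> cball p r" and y: "y \<in> cball p r" for x y
  proof -
    have ball: "p \<in> ball p e" "x \<in> ball p e" "y \<in> ball p e" using x y r e(1) by auto
    have p: "p \<in> cball p r" using r(1) by simp
    have 1: "norm (h p *\<^sub>R (g x - g y - M (x - y))) \<le> \<bar>h p\<bar> * (\<eta> * norm (x - y))"
      unfolding norm_scaleR by (intro mult_left_mono r1) (use x y r(2) in auto)
    have "\<bar>h x - h p\<bar> \<le> K * r"
      using lipschitz_onD[OF e(2) ball(2,1)] mult_left_mono[of "dist x p" r K] x K
      by (simp add: dist_real_def dist_commute)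
    then have 2: "norm ((h x - h p) *\<^sub>R (g x - g y)) \<le> (K * r) * (A * norm (x - y))"
      unfolding norm_scaleR using K r(1) by (intro mult_mono g_lip x y) auto
    have "norm (y - p) \<le> r" using y by (simp add: dist_norm norm_minus_commute)
    then have "A * norm (y - p) \<le> A * r" using A by (intro mult_left_mono) auto
    then have "norm (g y) \<le> A * r" using g_lip[OF y p] \<open>g p = 0\<close> by simp
    then have 3: "norm ((h x - h y) *\<^sub>R g y) \<le> (K * norm (x - y)) * (A * r)"
      unfolding norm_scaleR using lipschitz_onD[OF e(2) ball(2,3)] K
      by (intro mult_mono) (auto simp: dist_norm)
    have "h x *\<^sub>R g x - h y *\<^sub>R g y - h p *\<^sub>R M (x - y) =
        h p *\<^sub>R (g x - g y - M (x - y)) + (h x - h p) *\<^sub>R (g x - g y) + (h x - h y) *\<^sub>R g y"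
      by (simp add: algebra_simps)
    then have "norm (h x *\<^sub>R g x - h y *\<^sub>R g y - h p *\<^sub>R M (x - y)) \<le>
        norm (h p *\<^sub>R (g x - g y - M (x - y))) + norm ((h x - h p) *\<^sub>R (g x - g y)) + norm ((h x - h y) *\<^sub>R g y)"
      by (metis add_right_mono norm_triangle_ineq norm_triangle_le)
    also have "\<dots> \<le> (\<bar>h p\<bar> * \<eta> + 2 * (K * r * A)) * norm (x - y)"
      using 1 2 3 by (simp add: algebra_simps)
    also have "\<dots> \<le> \<epsilon> * norm (x - y)" using \<eta>(2) rK by (intro mult_right_mono) auto
    finally show ?thesis .
  qed
  with r(1) show ?thesis by blast
qed

text \<open>Compare \<open>F\<close> and \<open>S\<close> on a short multiple of \<open>v\<close>
  and rescale. With a = b = 1/2 this gives the bound norm (S v) <= norm v that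
  \<open>negligible_trapped_set\<close> asks for.\<close>

lemma strict_derivative_norm_le:
  fixes F :: "'a::real_normed_vector \<Rightarrow> 'b::real_normed_vector"
  assumes "linear S" and lip: "\<And>x y. norm (F x - F y) \<le> a * norm (x - y)"
    and strict: "\<exists>r>0. \<forall>x\<in>cball p r. \<forall>y\<in>cball p r. norm (F x - F y - S (x - y)) \<le> b * norm (x - y)"
  shows "norm (S v) \<le> (a + b) * norm v"
proof -
  obtain r where r: "r > 0" "\<And>x y. x \<in> cball p r \<Longrightarrow> y \<in> cball p r \<Longrightarrow>
      norm (F x - F y - S (x - y)) \<le> b * norm (x - y)"
    using strict by blast
  define t where "t = r / (norm v + 1)"
  have pos: "norm v + 1 > 0" by (smt (verit) norm_ge_zero)
  then have t: "t > 0" "norm (t *\<^sub>R v) \<le> r" using r(1) by (auto simp: t_def field_simps)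
  then have "norm (F (p + t *\<^sub>R v) - F p - S (t *\<^sub>R v)) \<le> b * norm (t *\<^sub>R v)"
    using r(2)[of "p + t *\<^sub>R v" p] r(1) by (simp add: dist_norm)
  then have "norm (S (t *\<^sub>R v)) \<le> (a + b) * norm (t *\<^sub>R v)"
    using lip[of "p + t *\<^sub>R v" p] norm_triangle_ineq4[of "F (p + t *\<^sub>R v) - F p" "F (p + t *\<^sub>R v) - F p - S (t *\<^sub>R v)"]
    by (simp add: algebra_simps)
  then have "t * norm (S v) \<le> t * ((a + b) * norm v)"
    using t(1) by (simp add: linear_cmul[OF \<open>linear S\<close>] mult.left_commute)
  then show ?thesis using t(1) by simp
qed

section \<open>Gradient descent with the smooth step size\<close>

text \<open>The components of the gradient are directional derivatives of \<open>f\<close>, hence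
  C^1 near \<open>p\<close>. The derivative \<open>D p\<close> assembled from them agrees with the
  Hessian matrix by uniqueness of derivatives.\<close>

lemma C2_near_gradient_strict_derivative:
  fixes f :: "real ^ 'k \<Rightarrow> real"
  assumes f: "\<And>x. GDERIV f x :> gradient f x" and "C2_near f p" and "\<epsilon> > 0"
  shows "\<exists>r>0. \<forall>x\<in>cball p r. \<forall>y\<in>cball p r.
    norm (gradient f x - gradient f y - hessian f p *v (x - y)) \<le> \<epsilon> * norm (x - y)"
proof -
  obtain U where U: "open U" "p \<in> U" "Ck_on (Suc (Suc 0)) f U"
    using assms(2) by (auto simp: C2_near_def numeral_2_eq_2)
  define G where "G b x = frechet_derivative f (at x) b" for b x
  define D where "D x v = (\<Sum>b\<in>Basis. frechet_derivative (G b) (at x) v *\<^sub>R b)" for x v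
  have inner_G: "gradient f x \<bullet> b = G b x" for x b
    using frechet_derivative_at[OF f[unfolded gderiv_def], of x, symmetric]
    by (simp add: G_def inner_commute)
  have grad: "gradient f = (\<lambda>x. \<Sum>b\<in>Basis. G b x *\<^sub>R b)"
  proof
    show "gradient f x = (\<Sum>b\<in>Basis. G b x *\<^sub>R b)" for x
      using euclidean_representation[of "gradient f x"] unfolding inner_G by (rule sym)
  qed
  have G: "Ck_on (Suc 0) (G b) U" for b
    unfolding G_def using U(3) by (rule Ck_on_frechet_derivative)
  have deriv: "(gradient f has_derivative D x) (at x)" if "x \<in> U" for x
    unfolding grad D_def
    by (intro has_derivative_sum has_derivative_scaleR_left Ck_on_has_derivative[OF G that])
  then have "(gradient f has_derivative (*v) (hessian f p)) (at p)"
    unfolding hessian_def using U(2) differentiableI jacobian_works by blast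
  then have D: "D p v = hessian f p *v v" for v
    using has_derivative_unique[OF deriv[OF U(2)]] by metis
  have "continuous_on U (\<lambda>x. D x v)" for v
    unfolding D_def using Ck_on_frechet_derivative[OF G, where v = v]
    by (intro continuous_on_sum continuous_on_scaleR continuous_on_const) simp
  from strict_derivative_if_continuous[OF U(1,2) deriv this \<open>\<epsilon> > 0\<close>]
  show ?thesis by (simp add: D)
qed

text \<open>An invertible Hessian is bounded below by some m > 0. With linearisation error m / 2, a
  zero \<open>y\<close> of the gradient near \<open>p\<close> satisfies m |y - p| <= (m / 2) |y -
  p|, so y = p.\<close>

lemma saddle_point_isolated:
  fixes f :: "real ^ 'k \<Rightarrow> real"
  assumes f: "\<And>x. GDERIV f x :> gradient f x" and p: "saddle_point f p"
  shows "p isolated_in {x. critical_point f x}"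
proof -
  have lin: "linear ((*v) (hessian f p))" by (rule matrix_vector_mul_linear)
  moreover have "inj ((*v) (hessian f p))"
    using p by (simp add: saddle_point_def invertible_eq_bij bij_is_inj)
  ultimately obtain m where m: "m > 0" "\<And>v. m * norm v \<le> norm (hessian f p *v v)"
    using linear_inj_bounded_below_pos by blast
  obtain r where r: "r > 0" "\<And>x y. x \<in> cball p r \<Longrightarrow> y \<in> cball p r \<Longrightarrow>
      norm (gradient f x - gradient f y - hessian f p *v (x - y)) \<le> m / 2 * norm (x - y)"
    using C2_near_gradient_strict_derivative[OF f, of p "m / 2"] p m(1)
    unfolding saddle_point_def by auto
  have "y = p" if y: "critical_point f y" "dist p y < r" for y
  proof -
    have "gradient f y = 0" "gradient f p = 0"
      using p y gradient_eqI by (auto simp: saddle_point_def critical_point_def)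
    then have "m * norm (y - p) \<le> m / 2 * norm (y - p)"
      using r(2)[of y p] r(1) y(2) m(2)[of "y - p"] by simp
    then have "norm (y - p) \<le> 0" using m(1) by simp
    then show ?thesis by simp
  qed
  with r(1) p show ?thesis
    unfolding isolated_in_dist_Ex_iff saddle_point_def by blast
qed

text \<open>One application of \<open>T\<close> is pulled back at a time: \<open>T\<close> maps the
  preimage into a null set and satisfies |x - y| <= 2 |T x - T y|.\<close>

lemma negligible_vimage_id_minus_half_lipschitz:
  fixes F :: "'a::euclidean_space \<Rightarrow> 'a"
  assumes T: "\<And>x. T x = x - F x" and lip: "\<And>x y. norm (F x - F y) \<le> 1 / 2 * norm (x - y)"
    and "negligible N"
  shows "negligible ((T ^^ m) -` N)"
proof (induction m)
  case 0
  show ?case using assms(3) by simp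
next
  case (Suc m)
  let ?S = "T -` ((T ^^ m) -` N)"
  have "negligible ?S"
  proof (rule negligible_expanding_image)
    show "norm (x - y) \<le> 2 * norm (T x - T y)" for x y
      using lip[of x y] norm_triangle_ineq[of "T x - T y" "F x - F y"] by (simp add: T)
    show "negligible (T ` ?S)" using Suc by (rule negligible_subset) auto
  qed
  then show ?case by (simp add: vimage_def funpow_swap1)
qed

text \<open>An orbit converging to a generalised saddle point \<open>p\<close> is eventually trapped
  in a ball around some centre \<open>q\<close> of a countable family, so its start lies in an
  iterated preimage of a null trapped set. The centre \<open>q\<close> may differ from
  \<open>p\<close>, which accommodates uncountably many such points.\<close>

lemma negligible_generalised_saddle_basins:
  fixes f :: "real ^ 'k \<Rightarrow> real"
  assumes f: "\<And>x. GDERIV f x :> gradient f x" and h: "locally_lipschitz h" "\<And>x. 0 < h x"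
    and H: "\<And>x. H x = x - h x *\<^sub>R gradient f x"
    and lip: "\<And>x y. norm (h x *\<^sub>R gradient f x - h y *\<^sub>R gradient f y) \<le> 1 / 2 * norm (x - y)"
  shows "\<exists>E. negligible E \<and>
    (\<forall>x p. x 0 \<notin> E \<longrightarrow> (\<forall>n. x (Suc n) = H (x n)) \<longrightarrow> generalised_saddle_point f p \<longrightarrow> \<not> x \<longlonglongrightarrow> p)"
proof -
  let ?W = "\<lambda>p r. {x. \<forall>n. (H ^^ n) x \<in> cball p r}"
  have local: "\<exists>r>0. negligible (?W p r)" if p: "generalised_saddle_point f p" for p
  proof -
    let ?A = "hessian f p" and ?S = "\<lambda>v. h p *\<^sub>R (hessian f p *v v)"
    have lin: "linear ((*v) ?A)" by (rule matrix_vector_mul_linear)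
    then have S: "linear ?S" by (rule linear_compose_scale_right)
    have p0: "gradient f p = 0"
      using p gradient_eqI by (auto simp: generalised_saddle_point_def critical_point_def)
    have strict: "\<exists>r>0. \<forall>x\<in>cball p r. \<forall>y\<in>cball p r.
      norm (gradient f x - gradient f y - ?A *v (x - y)) \<le> \<epsilon> * norm (x - y)" if "\<epsilon> > 0" for \<epsilon>
      using C2_near_gradient_strict_derivative[OF f _ that] p by (simp add: generalised_saddle_point_def)
    have strict_F: "\<exists>r>0. \<forall>x\<in>cball p r. \<forall>y\<in>cball p r.
      norm (h x *\<^sub>R gradient f x - h y *\<^sub>R gradient f y - ?S (x - y)) \<le> \<epsilon> * norm (x - y)" if "\<epsilon> > 0" for \<epsilon>
      by (rule strict_derivative_scaleR_zero[of "gradient f" p "(*v) ?A", OF p0 lin h(1) strict that])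
    have sym: "(?A *v x) \<bullet> y = x \<bullet> (?A *v y)" for x y
      by (rule strict_derivative_gradient_symmetric[OF f[unfolded gderiv_def] lin strict])
    have norm_S: "norm (?S v) \<le> norm v" for v
      using strict_derivative_norm_le[OF S lip strict_F[of "1/2"], of v] by simp
    obtain c v where c: "c < 0" "v \<noteq> 0" "?A *v v = c *\<^sub>R v"
      using p by (auto simp: generalised_saddle_point_def eigenvalue_def)
    have Sv: "?S v = (h p * c) *\<^sub>R v" by (simp add: c(3))
    have hc: "h p * c < 0" using h(2)[of p] c(1) by (simp add: mult_pos_neg)
    show ?thesis
      by (rule negligible_trapped_set[OF H strict_F S _ norm_S c(2) Sv hc]) (simp_all add: sym)
  qed
  let ?P = "{p. generalised_saddle_point f p}"
  obtain r where r: "\<And>p. p \<in> ?P \<Longrightarrow> r p > 0 \<and> negligible (?W p (r p))"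
    using bchoice[of ?P "\<lambda>p r. r > 0 \<and> negligible (?W p r)"] local by blast
  \<comment> \<open>Open balls are used for the Lindelof cover, the closed balls of the same radii
    as trapping regions.\<close>
  have open_balls: "open S" if "S \<in> (\<lambda>p. ball p (r p)) ` ?P" for S using that by auto
  obtain \<F> where \<F>: "\<F> \<subseteq> (\<lambda>p. ball p (r p)) ` ?P" "countable \<F>" "\<Union>\<F> = (\<Union>p\<in>?P. ball p (r p))"
    by (rule Lindelof[OF open_balls])
  obtain Q where Q: "Q \<subseteq> ?P" "countable Q" "\<F> = (\<lambda>p. ball p (r p)) ` Q"
    using countable_subset_image[THEN iffD1, OF conjI, OF \<F>(2,1)] by (elim exE conjE)
  define E where "E = (\<Union>m. \<Union>q\<in>Q. (H ^^ m) -` ?W q (r q))"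
  have "negligible E"
    unfolding E_def
  proof (intro negligible_countable_Union countable_image ballI countableI_type; clarify)
    fix m
    show "negligible (\<Union>q\<in>Q. (H ^^ m) -` ?W q (r q))"
    proof (intro negligible_countable_Union countable_image Q(2); clarify)
      fix q assume "q \<in> Q"
      then show "negligible ((H ^^ m) -` ?W q (r q))"
        using negligible_vimage_id_minus_half_lipschitz[OF H lip] r Q(1) by blast
    qed
  qed
  moreover have False
    if x0: "x 0 \<notin> E" and x: "\<And>n. x (Suc n) = H (x n)" and p: "generalised_saddle_point f p" and "x \<longlonglongrightarrow> p" for x p
  proof -
    have "p \<in> (\<Union>p\<in>?P. ball p (r p))" using p r[of p] by auto
    then have "p \<in> (\<Union>q\<in>Q. ball q (r q))" using \<F>(3) Q(3) by simp
    then obtain q where q: "q \<in> Q" "p \<in> ball q (r q)" by blast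
    have "\<forall>\<^sub>F n in sequentially. x n \<in> ball q (r q)"
      using topological_tendstoD[OF \<open>x \<longlonglongrightarrow> p\<close> open_ball q(2)] .
    then obtain m where m: "\<And>n. n \<ge> m \<Longrightarrow> x n \<in> ball q (r q)"
      unfolding eventually_sequentially by blast
    have iter: "x (n + k) = (H ^^ n) (x k)" for n k
      by (induction n) (simp_all add: x)
    have "(H ^^ n) ((H ^^ m) (x 0)) \<in> cball q (r q)" for n
      using m[of "n + m"] iter[of n m] iter[of m 0] by simp
    then have "x 0 \<in> E" using q(1) by (auto simp: E_def)
    with x0 show False ..
  qed
  ultimately show ?thesis by blast
qed

theorem theorem1p1:
  fixes f :: "real ^ 'k \<Rightarrow> real" and \<delta>\<^sub>0 \<alpha> :: real
  assumes "Ck_on 1 f UNIV"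
    and "locally_lipschitz (gradient f)"
    and "\<forall>p. generalised_saddle_point f p \<longrightarrow> C2_near f p"
    and "\<delta>\<^sub>0 > 0" and "0 < \<alpha>" and "\<alpha> < 1"
  shows "\<exists>(h :: real ^ 'k \<Rightarrow> real) (H :: real ^ 'k \<Rightarrow> real ^ 'k). smooth_on h UNIV \<and> (\<forall>x. 0 < h x \<and> h x \<le> \<delta>\<^sub>0) \<and>
    (\<forall>x. H x = x - h x *\<^sub>R gradient f x) \<and>
    (\<forall>x. f (H x) - f x \<le> - \<alpha> * h x * (norm (gradient f x))\<^sup>2) \<and>
    (\<forall>x::nat \<Rightarrow> real ^ 'k. (\<forall>n. x (Suc n) = H (x n)) \<longrightarrow>
       ((\<lambda>n. norm (x (Suc n) - x n)) \<longlonglongrightarrow> 0 \<or> filterlim (\<lambda>n. norm (x n)) at_top sequentially) \<and>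
       (\<forall>p. cluster_point x p \<longrightarrow> critical_point f p) \<and>
       (countable {p. critical_point f p} \<longrightarrow>
          (\<exists>p. critical_point f p \<and> x \<longlonglongrightarrow> p) \<or>
          filterlim (\<lambda>n. norm (x n)) at_top sequentially)) \<and>
    (\<exists>E1 \<in> null_sets lebesgue.
       \<forall>x::nat \<Rightarrow> real ^ 'k. x 0 \<notin> E1 \<and> (\<forall>n. x (Suc n) = H (x n)) \<longrightarrow>
         \<not> (\<exists>p. generalised_saddle_point f p \<and> x \<longlonglongrightarrow> p)) \<and>
    (\<exists>E2 \<in> null_sets lebesgue.
       \<forall>x::nat \<Rightarrow> real ^ 'k. x 0 \<notin> E2 \<and> (\<forall>n. x (Suc n) = H (x n)) \<longrightarrow>
         (\<forall>p. cluster_point x p \<longrightarrow>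
            \<not> saddle_point f p \<and> \<not> isolated_generalised_saddle_point f p))"
proof -
  let ?g = "gradient f"
  have f: "GDERIV f x :> ?g x" for x
    using assms(1) by (intro GDERIV_gradient) auto
  have f_cont: "continuous_on UNIV f"
    using Ck_on_Suc_imp_Ck_on[of 0 f UNIV] assms(1) by simp
  \<comment> \<open>The choice \<kappa> = 1 - \<alpha> makes the factor 1 - \<kappa> in
    \<open>gradient_step_descent\<close> equal to \<alpha>.\<close>
  obtain h where smooth: "smooth_on h UNIV" and h: "\<And>x. 0 < h x" "\<And>x. h x \<le> \<delta>\<^sub>0"
    and lip: "\<And>x y. norm (h x *\<^sub>R ?g x - h y *\<^sub>R ?g y) \<le> 1 / 2 * norm (x - y)"
    and le1: "\<And>x. norm (h x *\<^sub>R ?g x) \<le> 1"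
    and armijo: "\<And>x y. norm (y - x) \<le> 1 \<Longrightarrow> h x * norm (?g y - ?g x) \<le> (1 - \<alpha>) * norm (y - x)"
    using exists_smooth_step_size[OF assms(2,4), of "1 - \<alpha>"] assms(6) by auto
  define H where "H x = x - h x *\<^sub>R ?g x" for x
  have h_lip: "locally_lipschitz h"
    using smooth unfolding smooth_on_def by (intro Ck_on_1_imp_locally_lipschitz) blast
  have descent: "f (H x) - f x \<le> - \<alpha> * h x * (norm (?g x))\<^sup>2" for x
    using gradient_step_descent[OF f less_imp_le[OF h(1)] le1 armijo, of x] assms(6)
    by (simp add: H_def)
  have dichotomy: "(\<lambda>n. norm (x (Suc n) - x n)) \<longlonglongrightarrow> 0 \<or>
      filterlim (\<lambda>n. norm (x n)) at_top sequentially \<and> (\<forall>p. \<not> cluster_point x p)"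
    if x: "\<forall>n. x (Suc n) = H (x n)" for x :: "nat \<Rightarrow> real ^ 'k"
  proof -
    \<comment> \<open>The squared step is h^2 |gradient|^2; trading one factor \<open>h\<close> for
      its upper bound \<open>\<delta>\<^sub>0\<close> gives a descent estimate with a constant
      coefficient.\<close>
    have "\<alpha> / \<delta>\<^sub>0 * (norm (x (Suc n) - x n))\<^sup>2 \<le> f (x n) - f (x (Suc n))" for n
    proof -
      let ?y = "x n"
      have "\<alpha> / \<delta>\<^sub>0 * (norm (x (Suc n) - x n))\<^sup>2 = (\<alpha> * h ?y * (norm (?g ?y))\<^sup>2) * (h ?y / \<delta>\<^sub>0)"
        using x h(1)[of ?y] by (simp add: H_def power2_eq_square)
      also have "\<dots> \<le> (\<alpha> * h ?y * (norm (?g ?y))\<^sup>2) * 1"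
        using assms h(1)[of ?y] h(2)[of ?y] by (intro mult_left_mono) auto
      finally show ?thesis using descent[of ?y] x by simp
    qed
    then show ?thesis
      using descent_sequence_dichotomy[OF f_cont, of "\<alpha> / \<delta>\<^sub>0" x] assms by auto
  qed
  have critical: "critical_point f p"
    if x: "\<forall>n. x (Suc n) = H (x n)" and p: "cluster_point x p" for x :: "nat \<Rightarrow> real ^ 'k" and p
  proof -
    have "continuous_on UNIV (\<lambda>x. h x *\<^sub>R ?g x)"
      by (rule lipschitz_on_continuous_on[of "1/2"], rule lipschitz_onI) (use lip in \<open>auto simp: dist_norm\<close>)
    moreover have "(\<lambda>n. norm (x (Suc n) - x n)) \<longlonglongrightarrow> 0" using dichotomy[OF x] p by blast
    ultimately have "h p *\<^sub>R ?g p = 0"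
      by (intro cluster_point_step_zero[OF _ _ _ p]) (use x in \<open>auto simp: H_def\<close>)
    then show ?thesis using h(1)[of p] f[of p] by (simp add: critical_point_def)
  qed
  obtain E where E: "negligible E" "\<And>x p. x 0 \<notin> E \<Longrightarrow> \<forall>n. x (Suc n) = H (x n) \<Longrightarrow>
      generalised_saddle_point f p \<Longrightarrow> \<not> x \<longlonglongrightarrow> p"
    using negligible_generalised_saddle_basins[OF f h_lip h(1) H_def lip] by blast
  \<comment> \<open>An isolated critical point that is a cluster point is a limit, so (iv) reduces
    to (iii) and the null set \<open>E\<close> serves for both.\<close>
  have no_cluster: "\<not> isolated_generalised_saddle_point f p"
    if "x 0 \<notin> E" and x: "\<forall>n. x (Suc n) = H (x n)" and p: "cluster_point x p" for x :: "nat \<Rightarrow> real ^ 'k" and p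
  proof
    assume iso: "isolated_generalised_saddle_point f p"
    have "x \<longlonglongrightarrow> p"
    proof (rule converges_if_isolated_cluster_point[OF _ p])
      show "(\<lambda>n. norm (x (Suc n) - x n)) \<longlonglongrightarrow> 0" using dichotomy[OF x] p by blast
      show "p isolated_in {x. critical_point f x}"
        using iso by (simp add: isolated_generalised_saddle_point_def)
      show "q \<in> {x. critical_point f x}" if "cluster_point x q" for q using critical[OF x that] by simp
    qed
    with E(2)[OF that(1) x, of p] iso show False
      by (simp add: isolated_generalised_saddle_point_def)
  qed
  have saddle: "isolated_generalised_saddle_point f p" if "saddle_point f p" for p
    using that saddle_point_isolated[OF f that]
    by (auto simp: isolated_generalised_saddle_point_def generalised_saddle_point_def saddle_point_def)
  show ?thesis
  proof (intro exI[of _ h] exI[of _ H] conjI allI impI bexI[of _ E] notI; (elim conjE exE)?)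
    fix x :: "nat \<Rightarrow> real ^ 'k"
    assume x: "\<forall>n. x (Suc n) = H (x n)"
    show "(\<lambda>n. norm (x (Suc n) - x n)) \<longlonglongrightarrow> 0 \<or> filterlim (\<lambda>n. norm (x n)) at_top sequentially"
      using dichotomy[OF x] by blast
    show "critical_point f p" if "cluster_point x p" for p by (rule critical[OF x that])
    assume count: "countable {p. critical_point f p}"
    show "(\<exists>p. critical_point f p \<and> x \<longlonglongrightarrow> p) \<or> filterlim (\<lambda>n. norm (x n)) at_top sequentially"
    proof (rule disjCI)
      assume "\<not> filterlim (\<lambda>n. norm (x n)) at_top sequentially"
      then obtain p where p: "cluster_point x p" by (rule cluster_point_if_not_diverging)
      have countable: "countable {q. cluster_point x q}"
        by (rule countable_subset[OF _ count]) (use critical[OF x] in auto)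
      have steps: "(\<lambda>n. norm (x (Suc n) - x n)) \<longlonglongrightarrow> 0" using dichotomy[OF x] p by blast
      have "x \<longlonglongrightarrow> p" by (rule converges_if_countable_cluster_points[OF steps p countable])
      with critical[OF x p] show "\<exists>p. critical_point f p \<and> x \<longlonglongrightarrow> p" by blast
    qed
  next
    show "E \<in> null_sets lebesgue" "E \<in> null_sets lebesgue"
      using E(1) by (simp_all add: negligible_iff_null_sets)
  qed (use smooth h descent H_def E(2) no_cluster saddle in blast)+
qed

end
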